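(* Let $X$ be a complex Hilbert space. Let $T \in \mathcal{L}(X)$ be power-bounded, and suppose that $S \in \mathcal{L}(X)$ commutes with $T$. Let $\alpha > 0$ and $k \in \mathbb{N}$ satisfy $k > \alpha$. If $f \colon (0,\infty) \to (0,\infty)$ is $\alpha$-bounded regularly varying, then the following statements are equivalent: (i) $\|T^nS\| = O(1/f(n))$ as $n \to \infty$. (ii) There exists a constant $M>0$ such that $$\|R(\lambda,T)^{k} S\| \leq \frac{M}{(|\lambda|-1)^{k}f(1/(|\lambda|-1))}$$ for all $\lambda \in \mathbb{C}$ with $|\lambda|>1$.
   Context: $\mathcal{L}(X)$ denotes the space of bounded linear operators on $X$. An operator $T \in \mathcal{L}(X)$ is power-bounded if $\sup_{n \ge 0}\|T^n\| < \infty$ (then its spectral radius is at most $1$). For $\lambda$ in the resolvent set of $T$, $R(\lambda,T) = (\lambda I - T)^{-1}$. $\mathbb{N}$ is the set of positive integers. For $\alpha \ge 0$, a function $f \colon (0,\infty) \to (0,\infty)$ is called $\alpha$-bounded regularly varying if there exists $t_0>0$ such that $f$ is non-decreasing on $[t_0,\infty)$, is absolutely continuous on each compact subinterval of $[t_0,\infty)$, and satisfies $t f'(t)/f(t) \le \alpha$ for a.e. $t \ge t_0$. $a(n) = O(b(n))$ as $n\to\infty$ means there are constants $K>0$, $n_0$ with $a(n)\le K b(n)$ for all $n \ge n_0$.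
   Formalization: It is assumed in addition that f is bounded above on (0,b] for every b>0; otherwise (i) does not imply (ii), e.g. X=ℂ, T=0, S=I, k=1, α=1/2, f(t)=1/t for t<1 and f(t)=1 for t≥1. *)

theory Defs
  imports "HOL-Analysis.Analysis" "HOL-Library.Landau_Symbols"
begin

text \<open>
  Complex Hilbert spaces. The library only has real inner product spaces, so the complex structure
  is put on top of \<^class>\<open>real_inner\<close>: the underlying real scalar multiplication and real inner
  product are the restriction of the complex scalar multiplication and the real part of the complex
  inner product. Positive definiteness of \<open>cinner\<close> and \<open>norm x = sqrt (cinner x x)\<close> (note that
  \<open>cinner x x\<close> is real by conjugate symmetry) are then inherited from \<^class>\<open>real_inner\<close>.
\<close>

class complex_inner = real_inner +
  fixes scaleC :: "complex \<Rightarrow> 'a \<Rightarrow> 'a" (infixr \<open>*\<^sub>C\<close> 75)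
    and cinner :: "'a \<Rightarrow> 'a \<Rightarrow> complex"
  assumes scaleC_add_right: "a *\<^sub>C (x + y) = a *\<^sub>C x + a *\<^sub>C y"
    and scaleC_add_left: "(a + b) *\<^sub>C x = a *\<^sub>C x + b *\<^sub>C x"
    and scaleC_scaleC: "a *\<^sub>C b *\<^sub>C x = (a * b) *\<^sub>C x"
    and scaleR_scaleC: "r *\<^sub>R x = complex_of_real r *\<^sub>C x"
    and cinner_commute: "cinner x y = cnj (cinner y x)"
    and cinner_add_left: "cinner (x + y) z = cinner x z + cinner y z"
    and cinner_scaleC_left: "cinner (a *\<^sub>C x) y = a * cinner x y"
    and inner_eq_Re_cinner: "inner x y = Re (cinner x y)"

class complex_hilbert_space = complex_inner + complete_space

instantiation complex :: complex_hilbert_space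
begin

definition scaleC_complex :: "complex \<Rightarrow> complex \<Rightarrow> complex"
  where "scaleC_complex a x = a * x"

definition cinner_complex :: "complex \<Rightarrow> complex \<Rightarrow> complex"
  where "cinner_complex x y = x * cnj y"

instance
  by standard
    (auto simp: scaleC_complex_def cinner_complex_def algebra_simps scaleR_conv_of_real
      inner_complex_def)

end

text \<open>
  Operators are plain functions: composition is \<open>\<circ>\<close>, powers are \<open>^^\<close>, and the operator norm is
  \<^const>\<open>onorm\<close>.
\<close>

definition bounded_clinear :: "('a::complex_inner \<Rightarrow> 'b::complex_inner) \<Rightarrow> bool"
  where "bounded_clinear T \<longleftrightarrow> bounded_linear T \<and> (\<forall>a x. T (a *\<^sub>C x) = a *\<^sub>C T x)"

definition power_bounded :: "('a::complex_inner \<Rightarrow> 'a) \<Rightarrow> bool"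
  where "power_bounded T \<longleftrightarrow> bdd_above (range (\<lambda>n. onorm (T ^^ n)))"

text \<open>Meaningful only for \<open>z\<close> in the resolvent set of \<open>T\<close>.\<close>

definition resolvent :: "complex \<Rightarrow> ('a::complex_inner \<Rightarrow> 'a) \<Rightarrow> 'a \<Rightarrow> 'a"
  where "resolvent z T = inv (\<lambda>x. z *\<^sub>C x - T x)"

text \<open>
  Absolute continuity of a function on \<open>[a, b]\<close>; the library's \<^const>\<open>absolutely_continuous\<close> is about
  measures.
\<close>

definition abs_continuous_on_interval :: "real \<Rightarrow> real \<Rightarrow> (real \<Rightarrow> real) \<Rightarrow> bool"
  where "abs_continuous_on_interval a b f \<longleftrightarrow>
    (\<forall>\<epsilon>>0. \<exists>\<delta>>0. \<forall>(n::nat) u v.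
      (\<forall>i<n. a \<le> u i \<and> u i \<le> v i \<and> v i \<le> b) \<longrightarrow>
      disjoint_family_on (\<lambda>i. {u i<..<v i}) {..<n} \<longrightarrow>
      (\<Sum>i<n. v i - u i) < \<delta> \<longrightarrow>
      (\<Sum>i<n. \<bar>f (v i) - f (u i)\<bar>) < \<epsilon>)"

text \<open>
  A function \<open>(0,\<infinity>) \<rightarrow> (0,\<infinity>)\<close> is a total function that is positive on positive arguments;
  its values at \<open>t \<le> 0\<close> are irrelevant. Apart from positivity nothing is required below \<open>t\<^sub>0\<close>, so \<open>f\<close> may
  be unbounded on \<open>(0, t\<^sub>0)\<close>. The derivative is required to exist almost everywhere (which also follows
  from absolute continuity).
\<close>

definition bounded_regularly_varying :: "real \<Rightarrow> (real \<Rightarrow> real) \<Rightarrow> bool"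
  where "bounded_regularly_varying \<alpha> f \<longleftrightarrow>
    (\<forall>t>0. f t > 0) \<and>
    (\<exists>t\<^sub>0>0. mono_on {t\<^sub>0..} f \<and>
      (\<forall>a b. t\<^sub>0 \<le> a \<and> a \<le> b \<longrightarrow> abs_continuous_on_interval a b f) \<and>
      (AE t in lborel. t\<^sub>0 \<le> t \<longrightarrow>
        (\<exists>D. (f has_real_derivative D) (at t) \<and> t * D / f t \<le> \<alpha>)))"

end

theory Submission
  imports Defs
begin

text \<open>
  The expansion \<open>R(z,T)\<^sup>m = (\<Sum>n. ((n + m - 1) choose n) z\<^bsup>-n-m\<^esup> T\<^sup>n)\<close> links the two conditions.

  Decay implies the resolvent bound: let \<open>s = 1 / (\<bar>z\<bar> - 1)\<close>. The function \<open>ln \<circ> f\<close> is absolutely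
  continuous, so integrating its derivative bounds \<open>f s / f n\<close> by \<open>max 1 ((s / n) powr \<alpha>)\<close>.
  Inserting this into the series leaves \<open>s powr \<alpha> (\<Sum>n\<le>s. n powr (k - 1 - \<alpha>))\<close>, which is of order
  \<open>s\<^sup>k\<close> because \<open>\<alpha> < k\<close>.

  The resolvent bound implies decay: on the circle \<open>\<bar>z\<bar> = 1 + 1 / N\<close> the identity
  \<open>R\<^bsup>k+1\<^esup> S x = (R\<^sup>k S) (R x)\<close> bounds the norm of the left-hand side by that of \<open>R x\<close>, pointwise. By
  Parseval's identity in the Hilbert space the coefficients \<open>((n + k) choose n) r\<^bsup>-n-k-1\<^esup> T\<^sup>n S x\<close>
  are then square-summable with an explicit bound. The Cauchy-Schwarz inequality over \<open>n < N\<close> and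
  \<open>\<parallel>T\<^sup>N S x\<parallel> \<le> K \<parallel>T\<^sup>n S x\<parallel>\<close>, which power-boundedness provides in place of a duality argument, turn
  this into a bound on \<open>T\<^sup>N S x\<close>.
\<close>

hide_const (open) Polynomial.content

section \<open>Absolute continuity\<close>

lemma tagged_partial_division_intervalE:
  fixes a b :: real
  assumes "p tagged_partial_division_of {a..b}" "(x, K) \<in> p"
  obtains u v where "K = {u..v}" "a \<le> u" "u \<le> x" "x \<le> v" "v \<le> b"
proof -
  obtain u v where K: "K = {u..v}"
    using tagged_partial_division_ofD(4)[OF assms] by auto
  have "x \<in> K" "K \<subseteq> {a..b}"
    using tagged_partial_division_ofD(2,3)[OF assms] by auto
  then show thesis
    using that[OF K] K by auto
qed

lemma sum_content_tagged_partial_division_le_measure: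
  fixes p :: "('a::euclidean_space \<times> 'a set) set"
  assumes p: "p tagged_partial_division_of S" and sub: "\<And>x K. (x, K) \<in> p \<Longrightarrow> K \<subseteq> U"
    and U: "U \<in> lmeasurable"
  shows "(\<Sum>(x, K)\<in>p. content K) \<le> measure lebesgue U"
proof -
  note div = partial_division_of_tagged_division[OF p]
  have "(\<Sum>(x, K)\<in>p. content K) = (\<Sum>K\<in>snd ` p. content K)"
    by (rule sum.over_tagged_division_lemma[OF tagged_partial_division_of_Union_self[OF p]])
      (simp add: content_eq_0_interior)
  also have "\<dots> = (\<Sum>K\<in>snd ` p. measure lebesgue K)"
    using division_ofD(4)[OF div] by (intro sum.cong) (fastforce simp: measure_completion)+
  also have "\<dots> = measure lebesgue (\<Union>(snd ` p))"
    by (rule content_division[OF div])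
  also have "\<dots> \<le> measure lebesgue U"
  proof (rule measure_mono_fmeasurable[OF _ fmeasurableD[OF lmeasurable_division[OF div]] U])
    show "\<Union>(snd ` p) \<subseteq> U"
      using sub by fastforce
  qed
  finally show ?thesis .
qed

lemma abs_continuous_on_interval_partial_division:
  assumes "abs_continuous_on_interval a b f" "0 < \<epsilon>"
  shows "\<exists>\<delta>>0. \<forall>p. p tagged_partial_division_of {a..b} \<longrightarrow> (\<Sum>(x, K)\<in>p. content K) < \<delta> \<longrightarrow>
      (\<Sum>(x, K)\<in>p. \<bar>f (Sup K) - f (Inf K)\<bar>) < \<epsilon>"
proof -
  obtain \<delta> where "0 < \<delta>" and \<delta>: "\<And>n u v. \<forall>i<n::nat. a \<le> u i \<and> u i \<le> v i \<and> v i \<le> b \<Longrightarrow>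
      disjoint_family_on (\<lambda>i. {u i<..<v i}) {..<n} \<Longrightarrow> (\<Sum>i<n. v i - u i) < \<delta> \<Longrightarrow>
      (\<Sum>i<n. \<bar>f (v i) - f (u i)\<bar>) < \<epsilon>"
    using assms(1)[unfolded abs_continuous_on_interval_def, rule_format, OF assms(2)] by blast
  show ?thesis
  proof (intro exI[of _ \<delta>] conjI allI impI \<open>0 < \<delta>\<close>)
    fix p assume p: "p tagged_partial_division_of {a..b}" and small: "(\<Sum>(x, K)\<in>p. content K) < \<delta>"
    obtain h where h: "bij_betw h {..<card p} p"
      using ex_bij_betw_nat_finite[OF tagged_partial_division_ofD(1)[OF p]]
      by (auto simp: atLeast0LessThan)
    define u v where "u i = Inf (snd (h i))" and "v i = Sup (snd (h i))" for i
    have interval: "a \<le> u i \<and> u i \<le> v i \<and> v i \<le> b \<and> snd (h i) = {u i..v i}" if "i < card p" for i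
    proof -
      have "(fst (h i), snd (h i)) \<in> p"
        using h that by (auto simp: bij_betw_def)
      then obtain l r where "snd (h i) = {l..r}" "a \<le> l" "l \<le> fst (h i)" "fst (h i) \<le> r" "r \<le> b"
        by (rule tagged_partial_division_intervalE[OF p])
      then show ?thesis
        by (simp add: u_def v_def)
    qed
    have "{u i<..<v i} \<inter> {u j<..<v j} = {}" if "i < card p" "j < card p" "i \<noteq> j" for i j
    proof -
      have "h i \<in> p" "h j \<in> p" "h i \<noteq> h j"
        using h that by (auto simp: bij_betw_def inj_on_def)
      then have "interior (snd (h i)) \<inter> interior (snd (h j)) = {}"
        using tagged_partial_division_ofD(5)[OF p] by (metis prod.collapse)
      then show ?thesis
        using interval[OF that(1)] interval[OF that(2)] by simp
    qed
    then have "disjoint_family_on (\<lambda>i. {u i<..<v i}) {..<card p}"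
      by (auto simp: disjoint_family_on_def)
    moreover have "(\<Sum>i<card p. v i - u i) = (\<Sum>(x, K)\<in>p. content K)"
      unfolding sum.reindex_bij_betw[OF h, symmetric] using interval
      by (intro sum.cong) (auto simp: case_prod_beta)
    ultimately have "(\<Sum>i<card p. \<bar>f (v i) - f (u i)\<bar>) < \<epsilon>"
      using \<delta>[of "card p" u v] interval small by simp
    then show "(\<Sum>(x, K)\<in>p. \<bar>f (Sup K) - f (Inf K)\<bar>) < \<epsilon>"
      unfolding sum.reindex_bij_betw[OF h, symmetric] by (simp add: u_def v_def case_prod_beta)
  qed
qed

lemma abs_continuous_on_interval_lipschitz_comp:
  assumes f: "abs_continuous_on_interval a b f" and g: "L-lipschitz_on (f ` {a..b}) g"
  shows "abs_continuous_on_interval a b (g \<circ> f)"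
  unfolding abs_continuous_on_interval_def
proof (intro allI impI)
  fix \<epsilon> :: real assume "0 < \<epsilon>"
  have "0 \<le> L"
    by (rule lipschitz_on_nonneg[OF g])
  then have "0 < \<epsilon> / (L + 1)"
    using \<open>0 < \<epsilon>\<close> by simp
  obtain \<delta> where "0 < \<delta>" and \<delta>: "\<And>n u v. \<forall>i<n::nat. a \<le> u i \<and> u i \<le> v i \<and> v i \<le> b \<Longrightarrow>
      disjoint_family_on (\<lambda>i. {u i<..<v i}) {..<n} \<Longrightarrow> (\<Sum>i<n. v i - u i) < \<delta> \<Longrightarrow>
      (\<Sum>i<n. \<bar>f (v i) - f (u i)\<bar>) < \<epsilon> / (L + 1)"
    using f[unfolded abs_continuous_on_interval_def, rule_format, OF \<open>0 < \<epsilon> / (L + 1)\<close>] by blast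
  show "\<exists>\<delta>>0. \<forall>(n::nat) u v. (\<forall>i<n. a \<le> u i \<and> u i \<le> v i \<and> v i \<le> b) \<longrightarrow>
      disjoint_family_on (\<lambda>i. {u i<..<v i}) {..<n} \<longrightarrow> (\<Sum>i<n. v i - u i) < \<delta> \<longrightarrow>
      (\<Sum>i<n. \<bar>(g \<circ> f) (v i) - (g \<circ> f) (u i)\<bar>) < \<epsilon>"
  proof (intro exI[of _ \<delta>] conjI allI impI \<open>0 < \<delta>\<close>)
    fix n :: nat and u v :: "nat \<Rightarrow> real"
    assume intervals: "\<forall>i<n. a \<le> u i \<and> u i \<le> v i \<and> v i \<le> b"
      "disjoint_family_on (\<lambda>i. {u i<..<v i}) {..<n}" "(\<Sum>i<n. v i - u i) < \<delta>"
    have "(\<Sum>i<n. \<bar>(g \<circ> f) (v i) - (g \<circ> f) (u i)\<bar>) \<le> (\<Sum>i<n. L * \<bar>f (v i) - f (u i)\<bar>)"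
      using intervals(1) by (intro sum_mono)
        (force intro: lipschitz_onD[OF g, unfolded dist_real_def])
    also have "\<dots> \<le> (L + 1) * (\<Sum>i<n. \<bar>f (v i) - f (u i)\<bar>)"
      unfolding sum_distrib_left[symmetric] by (intro mult_right_mono sum_nonneg) auto
    also have "\<dots> < \<epsilon>"
      using \<delta>[OF intervals] \<open>0 \<le> L\<close> by (simp add: field_simps)
    finally show "(\<Sum>i<n. \<bar>(g \<circ> f) (v i) - (g \<circ> f) (u i)\<bar>) < \<epsilon>" .
  qed
qed

lemma has_vector_derivative_straddle:
  fixes f :: "real \<Rightarrow> 'a::real_normed_vector"
  assumes "(f has_vector_derivative D) (at x within S)" "0 < \<epsilon>"
  shows "\<exists>r>0. \<forall>u v. {u, v} \<subseteq> S \<inter> ball x r \<longrightarrow> u \<le> x \<longrightarrow> x \<le> v \<longrightarrow>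
    norm ((v - u) *\<^sub>R D - (f v - f u)) \<le> \<epsilon> * (v - u)"
proof -
  obtain r where "0 < r" and r: "\<And>y. y \<in> S \<Longrightarrow> norm (y - x) < r \<Longrightarrow>
      norm (f y - f x - (y - x) *\<^sub>R D) \<le> \<epsilon> * norm (y - x)"
    using assms unfolding has_vector_derivative_def has_derivative_within_alt by blast
  show ?thesis
  proof (intro exI[of _ r] conjI allI impI \<open>0 < r\<close>)
    fix u v assume uv: "{u, v} \<subseteq> S \<inter> ball x r" "u \<le> x" "x \<le> v"
    have "(v - u) *\<^sub>R D - (f v - f u)
        = (f u - f x - (u - x) *\<^sub>R D) - (f v - f x - (v - x) *\<^sub>R D)"
      by (simp add: algebra_simps)
    also have "norm \<dots> \<le> \<epsilon> * norm (u - x) + \<epsilon> * norm (v - x)"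
      using uv by (intro norm_triangle_le_diff add_mono r) (auto simp: dist_real_def)
    also have "\<dots> = \<epsilon> * (v - u)"
      using uv by (simp add: algebra_simps)
    finally show "norm ((v - u) *\<^sub>R D - (f v - f u)) \<le> \<epsilon> * (v - u)" .
  qed
qed

definition henstock_error ::
    "(real \<Rightarrow> 'a) \<Rightarrow> (real \<Rightarrow> 'a) \<Rightarrow> (real \<times> real set) set \<Rightarrow> 'a::real_normed_vector"
  where "henstock_error f g p = (\<Sum>(x, K)\<in>p. content K *\<^sub>R g x - (f (Sup K) - f (Inf K)))"

lemma henstock_error_tagged_division:
  assumes "a \<le> b" "p tagged_division_of {a..b}"
  shows "henstock_error f g p = (\<Sum>(x, K)\<in>p. content K *\<^sub>R g x) - (f b - f a)"
  unfolding additive_tagged_division_1[OF assms, symmetric] henstock_error_def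
  by (simp add: sum_subtractf case_prod_beta)

lemma henstock_error_split:
  assumes "finite p"
  shows "henstock_error f g p =
    henstock_error f g {q \<in> p. fst q \<in> N} + henstock_error f g {q \<in> p. fst q \<notin> N}"
proof -
  have "p = {q \<in> p. fst q \<in> N} \<union> {q \<in> p. fst q \<notin> N}"
    by auto
  then show ?thesis
    unfolding henstock_error_def using assms
    by (metis (no_types, lifting) disjoint_iff finite_Un mem_Collect_eq sum.union_disjoint)
qed

lemma negligible_outer_open:
  fixes N :: "'a::euclidean_space set"
  assumes "negligible N" "0 < \<delta>"
  shows "\<exists>U. open U \<and> N \<subseteq> U \<and> U \<in> lmeasurable \<and> measure lebesgue U < \<delta>"
proof -
  have null: "N \<in> null_sets lebesgue"
    using assms(1) by (simp add: negligible_iff_null_sets)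
  obtain U where U: "open U" "N \<subseteq> U" "U - N \<in> lmeasurable" "emeasure lebesgue (U - N) < ennreal \<delta>"
    using sets_lebesgue_outer_open[OF _ \<open>0 < \<delta>\<close>] null by blast
  have "U = (U - N) \<union> N"
    using U(2) by blast
  then have "U \<in> lmeasurable"
    using fmeasurable.Un[OF U(3) fmeasurableI_null_sets[OF null]] by simp
  moreover have "measure lebesgue (U - N) < \<delta>"
    using U(3,4) \<open>0 < \<delta>\<close> by (simp add: emeasure_eq_measure2 ennreal_less_iff)
  ultimately have "measure lebesgue U < \<delta>"
    using measure_Diff_null_set[OF fmeasurableD null] by metis
  with U(1,2) \<open>U \<in> lmeasurable\<close> show ?thesis
    by blast
qed

lemma henstock_error_small_on_negligible_tags:
  fixes f g :: "real \<Rightarrow> real"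
  assumes ac: "abs_continuous_on_interval a b f" and "negligible N" "0 < \<epsilon>"
    and g: "\<And>x. x \<in> N \<Longrightarrow> g x = 0"
  shows "\<exists>\<gamma>. gauge \<gamma> \<and> (\<forall>p. p tagged_partial_division_of {a..b} \<longrightarrow> \<gamma> fine p \<longrightarrow>
      fst ` p \<subseteq> N \<longrightarrow> norm (henstock_error f g p) < \<epsilon>)"
proof -
  obtain \<delta> where "0 < \<delta>" and \<delta>: "\<And>p. p tagged_partial_division_of {a..b} \<Longrightarrow>
      (\<Sum>(x, K)\<in>p. content K) < \<delta> \<Longrightarrow> (\<Sum>(x, K)\<in>p. \<bar>f (Sup K) - f (Inf K)\<bar>) < \<epsilon>"
    using abs_continuous_on_interval_partial_division[OF ac \<open>0 < \<epsilon>\<close>] by blast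
  obtain U where U: "open U" "N \<subseteq> U" "U \<in> lmeasurable" and measure_U: "measure lebesgue U < \<delta>"
    using negligible_outer_open[OF \<open>negligible N\<close> \<open>0 < \<delta>\<close>] by blast
  define \<gamma> where "\<gamma> x = (if x \<in> U then U else UNIV)" for x
  show ?thesis
  proof (intro exI conjI allI impI)
    show "gauge \<gamma>"
      using U(1) by (auto simp: gauge_def \<gamma>_def)
    fix p assume p: "p tagged_partial_division_of {a..b}" "\<gamma> fine p" "fst ` p \<subseteq> N"
    have "K \<subseteq> U" if "(x, K) \<in> p" for x K
    proof -
      have "x \<in> U"
        using p(3) that U(2) by force
      then show ?thesis
        using fineD[OF p(2) that] by (simp add: \<gamma>_def)
    qed
    then have "(\<Sum>(x, K)\<in>p. content K) \<le> measure lebesgue U"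
      using U(3) by (rule sum_content_tagged_partial_division_le_measure[OF p(1)])
    then have "(\<Sum>(x, K)\<in>p. content K) < \<delta>"
      using measure_U by linarith
    then have "(\<Sum>(x, K)\<in>p. \<bar>f (Sup K) - f (Inf K)\<bar>) < \<epsilon>"
      by (rule \<delta>[OF p(1)])
    moreover have "norm (henstock_error f g p) \<le> (\<Sum>(x, K)\<in>p. \<bar>f (Sup K) - f (Inf K)\<bar>)"
      unfolding henstock_error_def
    proof (rule sum_norm_le, clarify)
      fix x K assume "(x, K) \<in> p"
      then have "g x = 0"
        using p(3) g by force
      then show "norm (content K *\<^sub>R g x - (f (Sup K) - f (Inf K))) \<le> \<bar>f (Sup K) - f (Inf K)\<bar>"
        by (simp add: abs_minus_commute)
    qed
    ultimately show "norm (henstock_error f g p) < \<epsilon>"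
      by linarith
  qed
qed

lemma henstock_error_small_off_negligible_tags:
  fixes f :: "real \<Rightarrow> 'a::real_normed_vector"
  assumes "a \<le> b" "0 < \<epsilon>"
    and deriv: "\<And>x. x \<in> {a..b} - N \<Longrightarrow> (f has_vector_derivative g x) (at x within {a..b})"
  shows "\<exists>\<gamma>. gauge \<gamma> \<and> (\<forall>p. p tagged_partial_division_of {a..b} \<longrightarrow> \<gamma> fine p \<longrightarrow>
      fst ` p \<inter> N = {} \<longrightarrow> norm (henstock_error f g p) < \<epsilon>)"
proof -
  define \<eta> where "\<eta> = \<epsilon> / (b - a + 1)"
  have "0 < \<eta>" "\<eta> * (b - a) < \<epsilon>"
    using assms(1,2) by (auto simp: \<eta>_def field_simps)
  have "\<forall>x\<in>{a..b} - N. \<exists>r>0. \<forall>u v. {u, v} \<subseteq> {a..b} \<inter> ball x r \<longrightarrow> u \<le> x \<longrightarrow> x \<le> v \<longrightarrow>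
      norm ((v - u) *\<^sub>R g x - (f v - f u)) \<le> \<eta> * (v - u)"
    using has_vector_derivative_straddle[OF deriv \<open>0 < \<eta>\<close>] by blast
  then obtain r where r: "\<forall>x\<in>{a..b} - N. 0 < r x \<and> (\<forall>u v. {u, v} \<subseteq> {a..b} \<inter> ball x (r x) \<longrightarrow>
      u \<le> x \<longrightarrow> x \<le> v \<longrightarrow> norm ((v - u) *\<^sub>R g x - (f v - f u)) \<le> \<eta> * (v - u))"
    by (rule bchoice[THEN exE])
  define \<gamma> where "\<gamma> x = (if x \<in> {a..b} - N then ball x (r x) else UNIV)" for x
  show ?thesis
  proof (intro exI conjI allI impI)
    show "gauge \<gamma>"
      using r by (simp add: gauge_def \<gamma>_def)
    fix p assume p: "p tagged_partial_division_of {a..b}" "\<gamma> fine p" "fst ` p \<inter> N = {}"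
    have "norm (content K *\<^sub>R g x - (f (Sup K) - f (Inf K))) \<le> \<eta> * content K"
      if xK: "(x, K) \<in> p" for x K
    proof -
      obtain u v where K: "K = {u..v}" "a \<le> u" "u \<le> x" "x \<le> v" "v \<le> b"
        by (rule tagged_partial_division_intervalE[OF p(1) xK])
      have "x \<notin> N"
        using p(3) xK by force
      with K have "x \<in> {a..b} - N"
        by simp
      moreover from this K have "{u, v} \<subseteq> {a..b} \<inter> ball x (r x)"
        using fineD[OF p(2) xK] by (auto simp: \<gamma>_def simp del: mem_ball)
      ultimately show ?thesis
        using r K by simp
    qed
    then have "norm (henstock_error f g p) \<le> \<eta> * (\<Sum>(x, K)\<in>p. content K)"
      unfolding henstock_error_def sum_distrib_left by (intro sum_norm_le) auto
    also have "(\<Sum>(x, K)\<in>p. content K) \<le> measure lebesgue {a..b}"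
      using tagged_partial_division_ofD(3)[OF p(1)]
      by (rule sum_content_tagged_partial_division_le_measure[OF p(1)]) auto
    finally show "norm (henstock_error f g p) < \<epsilon>"
      using \<open>0 < \<eta>\<close> \<open>\<eta> * (b - a) < \<epsilon>\<close> \<open>a \<le> b\<close> by simp
  qed
qed

lemma has_integral_henstock_errorI:
  assumes "a \<le> b" and small: "\<And>e. 0 < e \<Longrightarrow> \<exists>\<gamma>. gauge \<gamma> \<and>
    (\<forall>p. p tagged_division_of {a..b} \<longrightarrow> \<gamma> fine p \<longrightarrow> norm (henstock_error f g p) < e)"
  shows "(g has_integral (f b - f a)) {a..b}"
  unfolding has_integral_real using small henstock_error_tagged_division[OF \<open>a \<le> b\<close>] by metis

theorem fundamental_theorem_of_calculus_abs_continuous: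
  fixes f f' :: "real \<Rightarrow> real"
  assumes "a \<le> b" and ac: "abs_continuous_on_interval a b f" and neg: "negligible N"
    and deriv: "\<And>x. x \<in> {a..b} - N \<Longrightarrow> (f has_vector_derivative f' x) (at x within {a..b})"
  shows "(f' has_integral (f b - f a)) {a..b}"
proof -
  define g where "g x = (if x \<in> N then 0 else f' x)" for x
  have g_deriv: "(f has_vector_derivative g x) (at x within {a..b})" if "x \<in> {a..b} - N" for x
    using deriv[OF that] that by (simp add: g_def)
  have "(g has_integral (f b - f a)) {a..b}"
  proof (rule has_integral_henstock_errorI[OF \<open>a \<le> b\<close>])
    fix e :: real assume "0 < e"
    then have "0 < e / 2"
      by simp
    obtain \<gamma>\<^sub>1 where "gauge \<gamma>\<^sub>1"
      and \<gamma>\<^sub>1: "\<And>p. p tagged_partial_division_of {a..b} \<Longrightarrow> \<gamma>\<^sub>1 fine p \<Longrightarrow> fst ` p \<subseteq> N \<Longrightarrow>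
        norm (henstock_error f g p) < e / 2"
      using henstock_error_small_on_negligible_tags[OF ac neg \<open>0 < e / 2\<close>, of g]
      by (auto simp: g_def)
    obtain \<gamma>\<^sub>2 where "gauge \<gamma>\<^sub>2"
      and \<gamma>\<^sub>2: "\<And>p. p tagged_partial_division_of {a..b} \<Longrightarrow> \<gamma>\<^sub>2 fine p \<Longrightarrow> fst ` p \<inter> N = {} \<Longrightarrow>
        norm (henstock_error f g p) < e / 2"
      using henstock_error_small_off_negligible_tags[of a b "e / 2" N f g,
          OF \<open>a \<le> b\<close> \<open>0 < e / 2\<close> g_deriv] by blast
    have "norm (henstock_error f g p) < e"
      if p: "p tagged_division_of {a..b}" "(\<lambda>x. \<gamma>\<^sub>1 x \<inter> \<gamma>\<^sub>2 x) fine p" for p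
    proof -
      let ?on = "{q \<in> p. fst q \<in> N}" and ?off = "{q \<in> p. fst q \<notin> N}"
      have partial: "q tagged_partial_division_of {a..b}" if "q \<subseteq> p" for q
        using p(1) that tagged_partial_division_subset unfolding tagged_division_of_def by blast
      have "norm (henstock_error f g ?on) < e / 2"
        by (intro \<gamma>\<^sub>1 partial) (use p(2) in \<open>auto simp: fine_def\<close>)
      moreover have "norm (henstock_error f g ?off) < e / 2"
        by (intro \<gamma>\<^sub>2 partial) (use p(2) in \<open>auto simp: fine_def\<close>)
      ultimately show ?thesis
        unfolding henstock_error_split[OF tagged_division_ofD(1)[OF p(1)], of f g N]
        by (intro norm_triangle_lt) simp
    qed
    then show "\<exists>\<gamma>. gauge \<gamma> \<and>
        (\<forall>p. p tagged_division_of {a..b} \<longrightarrow> \<gamma> fine p \<longrightarrow> norm (henstock_error f g p) < e)"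
      using gauge_Int[OF \<open>gauge \<gamma>\<^sub>1\<close> \<open>gauge \<gamma>\<^sub>2\<close>] by blast
  qed
  then show ?thesis
    by (rule has_integral_spike[OF neg, rotated]) (simp add: g_def)
qed

section \<open>Bounded regular variation\<close>

lemma lipschitz_on_ln:
  fixes m :: real
  assumes "0 < m"
  shows "(1 / m)-lipschitz_on {m..} ln"
proof (rule bounded_derivative_imp_lipschitz)
  fix x assume "x \<in> {m..}"
  with assms show "(ln has_derivative (\<lambda>h. h * (1 / x))) (at x within {m..})"
    by (auto intro!: derivative_eq_intros simp: divide_inverse)
  have "1 / x \<le> 1 / m"
    using assms \<open>x \<in> {m..}\<close> by (intro divide_left_mono) auto
  then have "norm h * (1 / x) \<le> norm h * (1 / m)" for h :: real
    by (rule mult_left_mono) simp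
  then show "onorm (\<lambda>h. h * (1 / x)) \<le> 1 / m"
    using assms \<open>x \<in> {m..}\<close> by (intro onorm_le) (simp add: abs_mult)
qed (use assms in auto)

lemma powr_growth_of_logarithmic_derivative_le:
  fixes f :: "real \<Rightarrow> real"
  assumes "0 < t" "t \<le> s" "0 < m" and bound: "\<And>x. x \<in> {t..s} \<Longrightarrow> m \<le> f x"
    and ac: "abs_continuous_on_interval t s f" and neg: "negligible N"
    and deriv: "\<And>x. x \<in> {t..s} - N \<Longrightarrow> (f has_real_derivative f' x) (at x) \<and> x * f' x / f x \<le> \<alpha>"
  shows "f s \<le> f t * (s / t) powr \<alpha>"
proof -
  define g where "g x = (if x \<in> N then \<alpha> / x else f' x / f x)" for x
  have pos: "0 < f x" "0 < x" if "x \<in> {t..s}" for x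
    using that bound[of x] assms(1,3) by auto
  have "(1 / m)-lipschitz_on (f ` {t..s}) ln"
    by (rule lipschitz_on_subset[OF lipschitz_on_ln[OF \<open>0 < m\<close>]]) (use bound in auto)
  then have "abs_continuous_on_interval t s (ln \<circ> f)"
    by (rule abs_continuous_on_interval_lipschitz_comp[OF ac])
  moreover have "((ln \<circ> f) has_vector_derivative g x) (at x within {t..s})"
    if "x \<in> {t..s} - N" for x
  proof -
    have "((\<lambda>x. ln (f x)) has_real_derivative g x) (at x)"
      using deriv[OF that] pos[of x] that by (auto simp: g_def intro!: derivative_eq_intros)
    then show ?thesis
      by (simp add: comp_def has_real_derivative_iff_has_vector_derivative
          has_vector_derivative_at_within)
  qed
  ultimately have "(g has_integral ((ln \<circ> f) s - (ln \<circ> f) t)) {t..s}"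
    by (rule fundamental_theorem_of_calculus_abs_continuous[OF \<open>t \<le> s\<close> _ neg])
  moreover have "((\<lambda>x. \<alpha> / x) has_integral (\<alpha> * ln s - \<alpha> * ln t)) {t..s}"
    using assms(1,2)
    by (intro fundamental_theorem_of_calculus)
      (auto intro!: derivative_eq_intros
        simp: has_real_derivative_iff_has_vector_derivative[symmetric])
  moreover have "g x \<le> \<alpha> / x" if "x \<in> {t..s}" for x
    using deriv[of x] pos[of x] that by (simp add: g_def field_simps)
  ultimately have "(ln \<circ> f) s - (ln \<circ> f) t \<le> \<alpha> * ln s - \<alpha> * ln t"
    by (rule has_integral_le)
  then have "ln (f s) \<le> ln (f t * (s / t) powr \<alpha>)"
    using assms(1,2) pos[of s] pos[of t] by (simp add: ln_mult ln_div ln_powr algebra_simps)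
  then show ?thesis
    using assms(1,2) pos[of s] pos[of t] by (simp add: ln_le_cancel_iff)
qed

lemma bounded_regularly_varying_pos:
  assumes "bounded_regularly_varying \<alpha> f" "0 < t"
  shows "0 < f t"
  using assms unfolding bounded_regularly_varying_def by blast

lemma bounded_regularly_varying_deriv:
  assumes "bounded_regularly_varying \<alpha> f"
  shows "\<exists>t\<^sub>0 N. 0 < t\<^sub>0 \<and> mono_on {t\<^sub>0..} f \<and> negligible N \<and>
    (\<forall>a b. t\<^sub>0 \<le> a \<longrightarrow> a \<le> b \<longrightarrow> abs_continuous_on_interval a b f) \<and>
    (\<forall>t. t\<^sub>0 \<le> t \<longrightarrow> t \<notin> N \<longrightarrow> (f has_real_derivative deriv f t) (at t) \<and> t * deriv f t / f t \<le> \<alpha>)"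
proof -
  from assms obtain t\<^sub>0 where "0 < t\<^sub>0" and mono: "mono_on {t\<^sub>0..} f"
    and ac: "\<And>a b. t\<^sub>0 \<le> a \<Longrightarrow> a \<le> b \<Longrightarrow> abs_continuous_on_interval a b f"
    and ae: "AE t in lborel. t\<^sub>0 \<le> t \<longrightarrow> (\<exists>D. (f has_real_derivative D) (at t) \<and> t * D / f t \<le> \<alpha>)"
    unfolding bounded_regularly_varying_def by blast
  from AE_E3[OF ae] obtain N where "N \<in> null_sets lborel"
    and ex_deriv: "\<And>t. t \<in> space lborel - N \<Longrightarrow>
      t\<^sub>0 \<le> t \<longrightarrow> (\<exists>D. (f has_real_derivative D) (at t) \<and> t * D / f t \<le> \<alpha>)"
    by metis
  have "negligible N"
    using \<open>N \<in> null_sets lborel\<close> by (simp add: negligible_iff_null_sets null_sets_completionI)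
  moreover have "(f has_real_derivative deriv f t) (at t) \<and> t * deriv f t / f t \<le> \<alpha>"
    if "t\<^sub>0 \<le> t" "t \<notin> N" for t
    using ex_deriv[of t] that by (auto simp: DERIV_imp_deriv)
  ultimately show ?thesis
    using \<open>0 < t\<^sub>0\<close> mono ac by blast
qed

lemma bounded_regularly_varying_growth:
  assumes "bounded_regularly_varying \<alpha> f"
  obtains t\<^sub>0 where "mono_on {t\<^sub>0..} f"
    "\<And>t s. t\<^sub>0 \<le> t \<Longrightarrow> t\<^sub>0 \<le> s \<Longrightarrow> f s \<le> f t * max 1 ((s / t) powr \<alpha>)"
proof -
  obtain t\<^sub>0 N where "0 < t\<^sub>0" and mono: "mono_on {t\<^sub>0..} f"
    and ac: "\<And>a b. t\<^sub>0 \<le> a \<Longrightarrow> a \<le> b \<Longrightarrow> abs_continuous_on_interval a b f" and neg: "negligible N"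
    and deriv: "\<And>t. t\<^sub>0 \<le> t \<Longrightarrow> t \<notin> N \<Longrightarrow>
      (f has_real_derivative deriv f t) (at t) \<and> t * deriv f t / f t \<le> \<alpha>"
    using bounded_regularly_varying_deriv[OF assms] by blast
  have "f s \<le> f t * max 1 ((s / t) powr \<alpha>)" if "t\<^sub>0 \<le> t" "t\<^sub>0 \<le> s" for t s
  proof (cases "t \<le> s")
    case True
    have "f s \<le> f t * (s / t) powr \<alpha>"
    proof (rule powr_growth_of_logarithmic_derivative_le[OF _ True _ _ ac[OF \<open>t\<^sub>0 \<le> t\<close> True] neg])
      show "0 < t" "0 < f t"
        using \<open>0 < t\<^sub>0\<close> \<open>t\<^sub>0 \<le> t\<close> bounded_regularly_varying_pos[OF assms] by auto
      show "f t \<le> f x" if "x \<in> {t..s}" for x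
        using mono \<open>t\<^sub>0 \<le> t\<close> that by (auto simp: mono_on_def)
      show "(f has_real_derivative deriv f x) (at x) \<and> x * deriv f x / f x \<le> \<alpha>"
        if "x \<in> {t..s} - N" for x
        using deriv[of x] \<open>t\<^sub>0 \<le> t\<close> that by auto
    qed
    also have "\<dots> \<le> f t * max 1 ((s / t) powr \<alpha>)"
      using \<open>0 < t\<^sub>0\<close> \<open>t\<^sub>0 \<le> t\<close> bounded_regularly_varying_pos[OF assms, of t]
      by (intro mult_left_mono) auto
    finally show ?thesis .
  next
    case False
    then have "f s \<le> f t * 1"
      using mono \<open>t\<^sub>0 \<le> s\<close> by (simp add: mono_on_def)
    also have "\<dots> \<le> f t * max 1 ((s / t) powr \<alpha>)"
      using \<open>0 < t\<^sub>0\<close> \<open>t\<^sub>0 \<le> t\<close> bounded_regularly_varying_pos[OF assms, of t]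
      by (intro mult_left_mono) auto
    finally show ?thesis .
  qed
  with mono show thesis
    by (rule that)
qed

lemma max_one_powr_double_le:
  fixes x y \<alpha> :: real
  assumes "0 \<le> x" "x \<le> 2 * y" "0 \<le> \<alpha>"
  shows "max 1 (x powr \<alpha>) \<le> 2 powr \<alpha> * max 1 (y powr \<alpha>)"
proof (rule max.boundedI)
  show "1 \<le> 2 powr \<alpha> * max 1 (y powr \<alpha>)"
    using mult_mono[of 1 "2 powr \<alpha>" 1 "max 1 (y powr \<alpha>)"] \<open>0 \<le> \<alpha>\<close> by (simp add: ge_one_powr_ge_zero)
  have "x powr \<alpha> \<le> 2 powr \<alpha> * y powr \<alpha>"
    using assms powr_mono2[of \<alpha> x "2 * y"] by (simp add: powr_mult)
  also have "\<dots> \<le> 2 powr \<alpha> * max 1 (y powr \<alpha>)"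
    by (intro mult_left_mono) auto
  finally show "x powr \<alpha> \<le> 2 powr \<alpha> * max 1 (y powr \<alpha>)" .
qed

lemma bounded_regularly_varying_le_max_powr_large:
  assumes f: "bounded_regularly_varying \<alpha> f" and "0 \<le> \<alpha>"
  shows "\<exists>m\<ge>1. (\<forall>n. f (real m) \<le> f (real (max n m))) \<and> (\<forall>n s. real m \<le> s \<longrightarrow>
    f s \<le> f (real (max n m)) * (2 powr \<alpha> * max 1 ((s / (real n + 1)) powr \<alpha>)))"
proof -
  obtain t\<^sub>0 where mono: "mono_on {t\<^sub>0..} f"
    and growth: "\<And>t s. t\<^sub>0 \<le> t \<Longrightarrow> t\<^sub>0 \<le> s \<Longrightarrow> f s \<le> f t * max 1 ((s / t) powr \<alpha>)"
    by (rule bounded_regularly_varying_growth[OF f]) blast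
  define m where "m = max 1 (nat \<lceil>t\<^sub>0\<rceil>)"
  have m: "1 \<le> m" "t\<^sub>0 \<le> real m"
    unfolding m_def using real_nat_ceiling_ge[of t\<^sub>0] by (auto simp: of_nat_max)
  have "f s \<le> f (real (max n m)) * (2 powr \<alpha> * max 1 ((s / (real n + 1)) powr \<alpha>))"
    if "real m \<le> s" for n s
  proof -
    have "0 < s"
      using m(1) that by linarith
    have "f s \<le> f (real (max n m)) * max 1 ((s / real (max n m)) powr \<alpha>)"
      using m that by (intro growth) auto
    also have "\<dots> \<le> f (real (max n m)) * (2 powr \<alpha> * max 1 ((s / (real n + 1)) powr \<alpha>))"
    proof (intro mult_left_mono max_one_powr_double_le)
      have "real n + 1 \<le> 2 * real (max n m)"
        using m(1) by linarith
      from mult_left_mono[OF this, of s] show "s / real (max n m) \<le> 2 * (s / (real n + 1))"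
        using m(1) \<open>0 < s\<close> by (simp add: field_simps)
      show "0 \<le> f (real (max n m))"
        using bounded_regularly_varying_pos[OF f, of "real (max n m)"] m(1) by force
    qed (use \<open>0 < s\<close> \<open>0 \<le> \<alpha>\<close> in auto)
    finally show ?thesis .
  qed
  moreover have "f (real m) \<le> f (real (max n m))" for n
    using mono m(2) by (auto simp: mono_on_def)
  ultimately show ?thesis
    using m(1) by blast
qed

lemma bounded_regularly_varying_le_max_powr:
  assumes f: "bounded_regularly_varying \<alpha> f" and "0 \<le> \<alpha>"
    and bdd: "\<And>b. 0 < b \<Longrightarrow> bdd_above (f ` {0<..b})"
  shows "\<exists>m\<ge>1. \<exists>C>0. \<forall>n s. 0 < s \<longrightarrow>
    f s \<le> C * f (real (max n m)) * max 1 ((s / (real n + 1)) powr \<alpha>)"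
proof -
  obtain m :: nat where "1 \<le> m" and f_m_le: "\<And>n. f (real m) \<le> f (real (max n m))"
    and large: "\<And>n s. real m \<le> s \<Longrightarrow>
      f s \<le> f (real (max n m)) * (2 powr \<alpha> * max 1 ((s / (real n + 1)) powr \<alpha>))"
    using bounded_regularly_varying_le_max_powr_large[OF f \<open>0 \<le> \<alpha>\<close>] by blast
  have f_m_pos: "0 < f (real m)"
    using bounded_regularly_varying_pos[OF f] \<open>1 \<le> m\<close> by simp
  have f_max_pos: "0 < f (real (max n m))" for n
    by (rule less_le_trans[OF f_m_pos f_m_le])
  obtain F where F: "\<forall>t\<in>{0<..real m}. f t \<le> F"
    using bdd[of "real m"] \<open>1 \<le> m\<close> unfolding bdd_above_def by auto
  define C where "C = max (F / f (real m)) (2 powr \<alpha>)"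
  have "0 < C"
    by (simp add: C_def less_max_iff_disj)
  have "f s \<le> C * f (real (max n m)) * max 1 ((s / (real n + 1)) powr \<alpha>)" if "0 < s" for n s
  proof (cases "s \<le> real m")
    case True
    have "f s \<le> F / f (real m) * f (real m) * 1"
      using F that True f_m_pos by simp
    also have "\<dots> \<le> C * f (real (max n m)) * max 1 ((s / (real n + 1)) powr \<alpha>)"
      using \<open>0 < C\<close> f_m_pos f_m_le f_max_pos[of n] by (intro mult_mono) (auto simp: C_def)
    finally show ?thesis .
  next
    case False
    then have "f s \<le> f (real (max n m)) * (2 powr \<alpha> * max 1 ((s / (real n + 1)) powr \<alpha>))"
      by (intro large) simp
    also have "\<dots> \<le> f (real (max n m)) * (C * max 1 ((s / (real n + 1)) powr \<alpha>))"
      using f_max_pos[of n] by (intro mult_left_mono mult_right_mono) (auto simp: C_def)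
    finally show ?thesis
      by (simp add: mult_ac)
  qed
  with \<open>1 \<le> m\<close> \<open>0 < C\<close> show ?thesis
    by blast
qed

lemma bigo_inverse_imp_bounded_product:
  fixes a g :: "nat \<Rightarrow> real"
  assumes "a \<in> O(\<lambda>n. 1 / g n)" and pos: "\<And>n. m \<le> n \<Longrightarrow> 0 < g n"
  obtains D where "0 < D" "\<And>n. g (max n m) * \<bar>a n\<bar> \<le> D"
proof -
  obtain c where "0 < c" and c: "\<forall>\<^sub>F n in sequentially. norm (a n) \<le> c * norm (1 / g n)"
    using assms(1) by (rule landau_o.bigE)
  have "\<forall>\<^sub>F n in sequentially. norm (g (max n m) * a n) \<le> norm c"
    using c eventually_ge_at_top[of m]
  proof eventually_elim
    case (elim n)
    then show ?case
      using pos[of n] \<open>0 < c\<close> by (simp add: abs_mult field_simps)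
  qed
  then have "Bseq (\<lambda>n. g (max n m) * a n)"
    by (rule Bseq_eventually_mono) simp
  then obtain D where "0 < D" and D: "\<And>n. norm (g (max n m) * a n) \<le> D"
    by (rule BseqE) blast
  with that pos show thesis
    by (simp add: abs_mult less_imp_le)
qed

lemma decay_rate_le_max_powr:
  fixes a :: "nat \<Rightarrow> real"
  assumes f: "bounded_regularly_varying \<alpha> f" and "0 \<le> \<alpha>"
    and bdd: "\<And>b. 0 < b \<Longrightarrow> bdd_above (f ` {0<..b})"
    and decay: "a \<in> O(\<lambda>n. 1 / f (real n))"
  obtains C where "0 < C" "\<And>n s. 0 < s \<Longrightarrow> f s * \<bar>a n\<bar> \<le> C * max 1 ((s / (real n + 1)) powr \<alpha>)"
proof -
  obtain m :: nat and C where "1 \<le> m" "0 < C"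
    and C: "\<And>n s. 0 < s \<Longrightarrow> f s \<le> C * f (real (max n m)) * max 1 ((s / (real n + 1)) powr \<alpha>)"
    using bounded_regularly_varying_le_max_powr[OF f \<open>0 \<le> \<alpha>\<close> bdd] by blast
  obtain D where "0 < D" and D: "\<And>n. f (real (max n m)) * \<bar>a n\<bar> \<le> D"
    using bigo_inverse_imp_bounded_product[OF decay, of m] bounded_regularly_varying_pos[OF f]
      \<open>1 \<le> m\<close> by auto
  have "f s * \<bar>a n\<bar> \<le> C * D * max 1 ((s / (real n + 1)) powr \<alpha>)" if "0 < s" for n s
  proof -
    let ?w = "max 1 ((s / (real n + 1)) powr \<alpha>)"
    have "f s * \<bar>a n\<bar> \<le> C * f (real (max n m)) * ?w * \<bar>a n\<bar>"
      by (intro mult_right_mono C that) simp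
    also have "\<dots> = C * ?w * (f (real (max n m)) * \<bar>a n\<bar>)"
      by simp
    also have "\<dots> \<le> C * ?w * D"
      using \<open>0 < C\<close> by (intro mult_left_mono D) simp
    finally show ?thesis
      by (simp add: mult_ac)
  qed
  moreover have "0 < C * D"
    using \<open>0 < C\<close> \<open>0 < D\<close> by simp
  ultimately show thesis
    using that by blast
qed

section \<open>Resolvent coefficients\<close>

definition resolvent_coeff :: "nat \<Rightarrow> 'a::field \<Rightarrow> nat \<Rightarrow> 'a"
  where "resolvent_coeff m z n = of_nat ((n + m - 1) choose n) / z ^ (n + m)"

lemma norm_resolvent_coeff:
  "norm (resolvent_coeff m z n) = resolvent_coeff m (norm z) n" for z :: "'a::real_normed_field"
  by (simp add: resolvent_coeff_def norm_divide norm_power)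

lemma resolvent_coeff_nonneg: "0 \<le> x \<Longrightarrow> 0 \<le> resolvent_coeff m x n" for x :: real
  by (simp add: resolvent_coeff_def)

lemma resolvent_coeff_0: "resolvent_coeff 0 z n = (if n = 0 then 1 else 0)"
  by (simp add: resolvent_coeff_def binomial_eq_0)

lemma resolvent_coeff_Suc_0: "z \<noteq> 0 \<Longrightarrow> z * resolvent_coeff (Suc m) z 0 = resolvent_coeff m z 0"
  by (simp add: resolvent_coeff_def)

lemma resolvent_coeff_Suc_Suc:
  assumes "z \<noteq> 0"
  shows "z * resolvent_coeff (Suc m) z (Suc n) =
    resolvent_coeff m z (Suc n) + resolvent_coeff (Suc m) z n"
proof -
  have "((Suc n + Suc m - 1) choose Suc n) =
      ((Suc n + m - 1) choose Suc n) + ((n + Suc m - 1) choose n)"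
    by simp
  then show ?thesis
    using assms by (simp add: resolvent_coeff_def field_simps)
qed

lemma resolvent_coeff_polar:
  "resolvent_coeff m (of_real r * cis t) n =
    cis (- (real m * t)) * (cis (- (real n * t)) * of_real (resolvent_coeff m r n))"
proof -
  have "(of_real r * cis t) ^ (n + m) =
      of_real (r ^ (n + m)) * (cis (real n * t) * cis (real m * t))"
    by (simp add: power_mult_distrib Complex.DeMoivre cis_mult distrib_right)
  then show ?thesis
    by (simp add: resolvent_coeff_def divide_inverse cis_inverse mult_ac)
qed

lemma sums_resolvent_coeff:
  fixes r :: real
  assumes "1 < r"
  shows "resolvent_coeff m r sums (1 / (r - 1) ^ m)"
proof -
  have "(- real m) gchoose n = (- 1) ^ n * real ((n + m - 1) choose n)" for n
  proof (cases "n + m = 0")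
    case False
    then have "real m + real n - 1 = real (n + m - 1)"
      by (cases m; cases n) auto
    then show ?thesis
      by (simp add: gbinomial_minus binomial_gbinomial)
  qed simp
  then have "real ((n + m - 1) choose n) * (1 / r) ^ n =
      ((- real m) gchoose n) * (- (1 / r)) ^ n" for n
    by (simp add: power_minus[of "1 / r"] flip: power_add mult_2)
  moreover have "(\<lambda>n. ((- real m) gchoose n) * (- (1 / r)) ^ n) sums
      (1 + - (1 / r)) powr (- real m)"
    using assms by (intro gen_binomial_real) auto
  ultimately have "(\<lambda>n. real ((n + m - 1) choose n) * (1 / r) ^ n * (1 / r) ^ m) sums
      ((1 + - (1 / r)) powr (- real m) * (1 / r) ^ m)"
    by (intro sums_mult2) simp
  moreover have "(1 + - (1 / r)) powr (- real m) * (1 / r) ^ m = 1 / (r - 1) ^ m"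
    using assms by (simp add: powr_minus powr_realpow field_simps flip: power_mult_distrib)
  ultimately show ?thesis
    by (simp add: resolvent_coeff_def[abs_def] power_add power_one_over field_simps)
qed

lemma binomial_le_power: "((n + j) choose n) \<le> (n + 1) ^ j"
proof (induction j arbitrary: n)
  case (Suc j)
  have "((n + Suc j) choose n) = (\<Sum>i\<le>n. (j + i) choose i)"
    using sum_choose_lower[of j n] by (simp add: add.commute)
  also have "\<dots> \<le> (\<Sum>i\<le>n. (n + 1) ^ j)"
  proof (rule sum_mono)
    fix i assume "i \<in> {..n}"
    have "(j + i) choose i \<le> (i + 1) ^ j"
      using Suc.IH[of i] by (simp add: add.commute)
    also have "\<dots> \<le> (n + 1) ^ j"
      using \<open>i \<in> {..n}\<close> by (intro power_mono) auto
    finally show "(j + i) choose i \<le> (n + 1) ^ j" .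
  qed
  finally show ?case
    by simp
qed simp

lemma power_le_fact_mult_binomial: "Suc n ^ j \<le> fact j * ((n + j) choose j)"
proof (induction j)
  case (Suc j)
  have "Suc n ^ Suc j \<le> Suc (n + j) * (fact j * ((n + j) choose j))"
    unfolding power_Suc using Suc by (intro mult_mono) auto
  also have "\<dots> = fact j * (Suc (n + j) * ((n + j) choose j))"
    by (simp only: mult_ac)
  also have "\<dots> = fact (Suc j) * ((n + Suc j) choose Suc j)"
    by (simp only: Suc_times_binomial_eq fact_Suc of_nat_id mult_ac add_Suc_right)
  finally show ?case .
qed simp

lemma resolvent_coeff_Suc_le_power:
  fixes r :: real
  assumes "1 \<le> r"
  shows "resolvent_coeff (Suc j) r n \<le> (real n + 1) ^ j"
proof -
  have "resolvent_coeff (Suc j) r n \<le> real ((n + j) choose n) / 1"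
    unfolding resolvent_coeff_def using assms by (intro frac_le) (auto simp del: power_Suc)
  also have "\<dots> \<le> real ((n + 1) ^ j)"
    unfolding div_by_1 of_nat_le_iff by (rule binomial_le_power)
  finally show ?thesis
    by (simp add: add.commute)
qed

lemma binomial_le_exp_mult_resolvent_coeff:
  assumes "n < N"
  shows "real ((k + n) choose n) \<le> exp (real (Suc k)) * resolvent_coeff (Suc k) (1 + 1 / real N) n"
proof -
  define r where "r = 1 + 1 / real N"
  have "0 < r"
    by (simp add: r_def add_pos_nonneg)
  have "r ^ (n + Suc k) \<le> exp (1 / real N) ^ (n + Suc k)"
    unfolding r_def by (intro power_mono exp_ge_add_one_self) simp
  also have "\<dots> = exp (real (n + Suc k) / real N)"
    by (simp only: exp_of_nat_mult[symmetric] times_divide_eq_right mult_1_right)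
  also have "\<dots> \<le> exp (real (Suc k))"
  proof -
    obtain M where "N = Suc M" "n \<le> M"
      using assms by (cases N) auto
    then have "n + Suc k \<le> N * Suc k"
      by simp
    then have "real (n + Suc k) \<le> real N * real (Suc k)"
      by (simp only: of_nat_mult[symmetric] of_nat_le_iff)
    then show ?thesis
      using assms by (simp add: divide_le_eq mult.commute)
  qed
  finally have "real ((k + n) choose n) * r ^ (n + Suc k) \<le>
      real ((k + n) choose n) * exp (real (Suc k))"
    by (rule mult_left_mono) simp
  then show ?thesis
    unfolding r_def[symmetric] using \<open>0 < r\<close>
    by (simp add: resolvent_coeff_def field_simps add.commute del: power_Suc of_nat_Suc)
qed

lemma power_le_fact_mult_sum_binomial: "N ^ Suc k \<le> fact (Suc k) * (\<Sum>n<N. (k + n) choose n)"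
proof (cases N)
  case (Suc M)
  have "(\<Sum>n<N. (k + n) choose n) = (M + Suc k) choose Suc k"
    using sum_choose_lower[of k M] binomial_symmetric[of "Suc k" "M + Suc k"]
    by (simp add: Suc lessThan_Suc_atMost add.commute)
  then show ?thesis
    using power_le_fact_mult_binomial[of M "Suc k"] Suc by simp
qed simp

lemma power_le_sum_resolvent_coeff:
  "real N ^ Suc k \<le>
    fact (Suc k) * exp (real (Suc k)) * (\<Sum>n<N. resolvent_coeff (Suc k) (1 + 1 / real N) n)"
proof -
  have "real (N ^ Suc k) \<le> real (fact (Suc k) * (\<Sum>n<N. (k + n) choose n))"
    unfolding of_nat_le_iff by (rule power_le_fact_mult_sum_binomial)
  then have "real N ^ Suc k \<le> fact (Suc k) * (\<Sum>n<N. real ((k + n) choose n))"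
    by (simp only: of_nat_mult of_nat_sum of_nat_power of_nat_fact)
  also have "\<dots> \<le> fact (Suc k) *
      (\<Sum>n<N. exp (real (Suc k)) * resolvent_coeff (Suc k) (1 + 1 / real N) n)"
    by (intro mult_left_mono sum_mono binomial_le_exp_mult_resolvent_coeff) auto
  finally show ?thesis
    by (simp add: sum_distrib_left mult.assoc)
qed

lemma sum_powr_minus_one_le:
  fixes \<gamma> :: real
  assumes "0 < \<gamma>" "\<gamma> \<le> 1"
  shows "(\<Sum>n<N. (real n + 1) powr (\<gamma> - 1)) \<le> real N powr \<gamma> / \<gamma>"
proof (induction N)
  case (Suc N)
  have "(real N + 1) powr (\<gamma> - 1) \<le> ((real N + 1) powr \<gamma> - real N powr \<gamma>) / \<gamma>"
  proof (cases "N = 0")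
    case True
    then show ?thesis
      using assms by simp
  next
    case False
    have "\<exists>x. real N < x \<and> x < real N + 1 \<and>
        (real N + 1) powr \<gamma> - real N powr \<gamma> = (real N + 1 - real N) * (\<gamma> * x powr (\<gamma> - 1))"
      using False by (intro MVT2) (auto intro!: derivative_eq_intros simp: field_simps powr_diff)
    then obtain x where x: "real N < x" "x < real N + 1"
      "(real N + 1) powr \<gamma> - real N powr \<gamma> = \<gamma> * x powr (\<gamma> - 1)"
      by auto
    have "(real N + 1) powr (\<gamma> - 1) \<le> x powr (\<gamma> - 1)"
      using x assms by (intro powr_mono2') auto
    then show ?thesis
      using x(3) assms by simp
  qed
  with Suc show ?case
    by (simp add: diff_divide_distrib add.commute)
qed simp

lemma sum_resolvent_coeff_powr_le:
  fixes r s \<beta> :: real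
  assumes "1 \<le> r" "0 < s" "real N \<le> s" "real k - 1 \<le> \<beta>" "\<beta> < real k" "1 \<le> k"
  shows "(\<Sum>n<N. resolvent_coeff k r n * (s / (real n + 1)) powr \<beta>) \<le> s ^ k / (real k - \<beta>)"
proof -
  define \<gamma> where "\<gamma> = real k - \<beta>"
  have \<gamma>: "0 < \<gamma>" "\<gamma> \<le> 1"
    using assms by (auto simp: \<gamma>_def)
  obtain j where j: "k = Suc j"
    using \<open>1 \<le> k\<close> by (cases k) auto
  have "resolvent_coeff k r n * (s / (real n + 1)) powr \<beta>
      \<le> s powr \<beta> * (real n + 1) powr (\<gamma> - 1)" for n
  proof -
    have "resolvent_coeff k r n * (s / (real n + 1)) powr \<beta>
        \<le> (real n + 1) powr real j * (s / (real n + 1)) powr \<beta>"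
      using resolvent_coeff_Suc_le_power[OF assms(1), of j n]
      by (intro mult_right_mono) (auto simp: j powr_realpow add_nonneg_pos)
    also have "\<dots> = s powr \<beta> * (real n + 1) powr (\<gamma> - 1)"
      using \<open>0 < s\<close> by (simp add: \<gamma>_def j powr_divide powr_diff algebra_simps)
    finally show ?thesis .
  qed
  then have "(\<Sum>n<N. resolvent_coeff k r n * (s / (real n + 1)) powr \<beta>)
      \<le> s powr \<beta> * (\<Sum>n<N. (real n + 1) powr (\<gamma> - 1))"
    unfolding sum_distrib_left by (rule sum_mono)
  also have "\<dots> \<le> s powr \<beta> * (s powr \<gamma> / \<gamma>)"
  proof (rule mult_left_mono)
    have "(\<Sum>n<N. (real n + 1) powr (\<gamma> - 1)) \<le> real N powr \<gamma> / \<gamma>"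
      by (rule sum_powr_minus_one_le[OF \<gamma>])
    also have "\<dots> \<le> s powr \<gamma> / \<gamma>"
      using assms \<gamma> by (intro divide_right_mono powr_mono2) auto
    finally show "(\<Sum>n<N. (real n + 1) powr (\<gamma> - 1)) \<le> s powr \<gamma> / \<gamma>" .
  qed simp
  also have "\<dots> = s ^ k / (real k - \<beta>)"
    using \<open>0 < s\<close> by (simp add: \<gamma>_def powr_realpow flip: powr_add)
  finally show ?thesis .
qed

lemma max_one_powr_le:
  fixes y \<alpha> \<beta> :: real
  assumes "0 \<le> y" "0 \<le> \<alpha>" "\<alpha> \<le> \<beta>"
  shows "max 1 (y powr \<alpha>) \<le> 1 + (if 1 \<le> y then y powr \<beta> else 0)"
proof (cases "1 \<le> y")
  case True
  then have "y powr \<alpha> \<le> y powr \<beta>"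
    by (rule powr_mono[OF \<open>\<alpha> \<le> \<beta>\<close>])
  with True show ?thesis
    by (simp add: add_increasing)
next
  case False
  then have "y powr \<alpha> \<le> 1"
    using assms by (intro powr_le1) auto
  with False show ?thesis
    by simp
qed

lemma resolvent_coeff_max_powr_sums:
  fixes r s \<alpha> \<beta> :: real
  assumes "1 < r" and s: "s = 1 / (r - 1)" and "1 \<le> k"
    and "0 \<le> \<alpha>" "\<alpha> \<le> \<beta>" "real k - 1 \<le> \<beta>" "\<beta> < real k"
  shows "\<exists>B\<le>(1 + 1 / (real k - \<beta>)) * s ^ k.
    (\<lambda>n. resolvent_coeff k r n * max 1 ((s / (real n + 1)) powr \<alpha>)) sums B"
proof -
  have "0 < s" and s_power: "s ^ k = 1 / (r - 1) ^ k"
    using \<open>1 < r\<close> by (auto simp: s power_one_over)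
  define N where "N = nat \<lfloor>s\<rfloor>"
  have "real N \<le> s"
    using \<open>0 < s\<close> by (simp add: N_def)
  have N_iff: "1 \<le> s / (real n + 1) \<longleftrightarrow> n \<in> {..<N}" for n
    using \<open>0 < s\<close> by (simp add: N_def) linarith
  let ?f = "\<lambda>n. resolvent_coeff k r n * max 1 ((s / (real n + 1)) powr \<alpha>)"
  let ?g = "\<lambda>n. resolvent_coeff k r n +
    (if n \<in> {..<N} then resolvent_coeff k r n * (s / (real n + 1)) powr \<beta> else 0)"
  let ?G = "s ^ k + (\<Sum>n<N. resolvent_coeff k r n * (s / (real n + 1)) powr \<beta>)"
  have g: "?g sums ?G"
    unfolding s_power using \<open>1 < r\<close>
    by (intro sums_add sums_If_finite_set sums_resolvent_coeff) auto
  have f_le_g: "?f n \<le> ?g n" for n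
  proof -
    have "?f n \<le> resolvent_coeff k r n *
        (1 + (if n \<in> {..<N} then (s / (real n + 1)) powr \<beta> else 0))"
      using assms(1,4,5) \<open>0 < s\<close> unfolding N_iff[symmetric]
      by (intro mult_left_mono resolvent_coeff_nonneg max_one_powr_le) auto
    then show ?thesis
      by (simp add: distrib_left split: if_splits)
  qed
  have "summable ?f"
    using f_le_g \<open>1 < r\<close>
    by (intro summable_comparison_test'[OF sums_summable[OF g]])
      (auto simp: resolvent_coeff_nonneg abs_mult)
  have "suminf ?f \<le> ?G"
    by (rule sums_le[OF f_le_g summable_sums[OF \<open>summable ?f\<close>] g])
  also have "\<dots> \<le> s ^ k + s ^ k / (real k - \<beta>)"
    using assms(1,3,6,7) \<open>0 < s\<close> \<open>real N \<le> s\<close>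
    by (intro add_left_mono sum_resolvent_coeff_powr_le) auto
  also have "\<dots> = (1 + 1 / (real k - \<beta>)) * s ^ k"
    by (simp add: distrib_right)
  finally show ?thesis
    using summable_sums[OF \<open>summable ?f\<close>] by blast
qed

lemma resolvent_coeff_max_powr_bounded:
  fixes \<alpha> :: real
  assumes "0 \<le> \<alpha>" "\<alpha> < real k" "1 \<le> k"
  shows "\<exists>D>0. \<forall>r s. 1 < r \<longrightarrow> s = 1 / (r - 1) \<longrightarrow> (\<exists>B\<le>D * s ^ k.
    (\<lambda>n. resolvent_coeff k r n * max 1 ((s / (real n + 1)) powr \<alpha>)) sums B)"
proof -
  \<comment> \<open>An exponent in \<open>[k - 1, k)\<close> makes \<open>(n + 1) powr (k - 1 - \<beta>)\<close> decreasing, so that its sum can be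
    compared with an integral.\<close>
  define \<beta> where "\<beta> = max \<alpha> (real k - 1)"
  have \<beta>: "\<alpha> \<le> \<beta>" "real k - 1 \<le> \<beta>" "\<beta> < real k"
    using assms by (auto simp: \<beta>_def)
  have "0 < 1 + 1 / (real k - \<beta>)"
    using \<beta>(3) by (simp add: add_pos_pos)
  moreover note resolvent_coeff_max_powr_sums[OF _ _ assms(3,1) \<beta>]
  ultimately show ?thesis
    by blast
qed

section \<open>Parseval's identity\<close>

instance complex_hilbert_space \<subseteq> banach ..

lemma norm_scaleC: "norm (a *\<^sub>C x) = cmod a * norm (x :: 'a::complex_inner)"
proof -
  have "cinner (a *\<^sub>C x) (a *\<^sub>C x) = a * cnj (a * cinner x x)"
    by (metis cinner_commute cinner_scaleC_left)
  also have "\<dots> = complex_of_real ((cmod a)\<^sup>2) * cinner x x"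
    by (metis cinner_commute complex_cnj_mult complex_norm_square mult.assoc)
  finally have "(norm (a *\<^sub>C x))\<^sup>2 = (cmod a * norm x)\<^sup>2"
    by (simp add: power2_norm_eq_inner inner_eq_Re_cinner power_mult_distrib)
  then show ?thesis
    by (simp add: power2_eq_iff_nonneg)
qed

lemma bounded_linear_scaleC: "bounded_linear (\<lambda>x :: 'a::complex_inner. a *\<^sub>C x)"
proof (rule bounded_linear_intro)
  fix r :: real and x :: 'a
  show "a *\<^sub>C (r *\<^sub>R x) = r *\<^sub>R a *\<^sub>C x"
    by (simp add: scaleR_scaleC scaleC_scaleC mult.commute)
  show "norm (a *\<^sub>C x) \<le> norm x * cmod a"
    by (simp add: norm_scaleC mult.commute)
qed (simp add: scaleC_add_right)

lemma scaleC_one: "1 *\<^sub>C x = (x :: 'a::complex_inner)"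
  by (metis of_real_1 scaleR_one scaleR_scaleC)

lemma scaleC_zero: "0 *\<^sub>C x = (0 :: 'a::complex_inner)"
  by (metis of_real_0 scaleR_zero_left scaleR_scaleC)

lemma has_integral_Re_cis:
  "((\<lambda>t. Re (cis (of_int j * t) * c)) has_integral (if j = 0 then 2 * pi * Re c else 0))
    {0..2 * pi}"
proof (cases "j = 0")
  case True
  then show ?thesis
    using has_integral_const_real[of "Re c" 0 "2 * pi"] by simp
next
  case False
  let ?F = "\<lambda>t. (sin (of_int j * t) * Re c + cos (of_int j * t) * Im c) / of_int j"
  have "((\<lambda>t. Re (cis (of_int j * t) * c)) has_integral (?F (2 * pi) - ?F 0)) {0..2 * pi}"
  proof (rule fundamental_theorem_of_calculus)
    fix t :: real
    have "(?F has_real_derivative Re (cis (of_int j * t) * c)) (at t within {0..2 * pi})"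
      using False by (auto intro!: derivative_eq_intros simp: field_simps)
    then show "(?F has_vector_derivative Re (cis (of_int j * t) * c)) (at t within {0..2 * pi})"
      by (simp add: has_real_derivative_iff_has_vector_derivative)
  qed simp
  moreover have "of_int j * (2 * pi) = 2 * pi * of_int j"
    by simp
  ultimately show ?thesis
    using False by (simp add: sin_int_2pin cos_int_2pin del: mult_cancel_left mult_cancel_right)
qed

lemma inner_scaleC_cis:
  fixes x y :: "'a::complex_inner"
  shows "inner (cis (- (real n * t)) *\<^sub>C x) (cis (- (real m * t)) *\<^sub>C y)
    = Re (cis (of_int (int m - int n) * t) * cinner x y)"
proof -
  have "cinner (cis (- (real n * t)) *\<^sub>C x) (cis (- (real m * t)) *\<^sub>C y)
      = cis (- (real n * t)) * cnj (cis (- (real m * t)) * cnj (cinner x y))"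
    by (metis cinner_commute cinner_scaleC_left complex_cnj_cnj)
  also have "\<dots> = cis (of_int (int m - int n) * t) * cinner x y"
    unfolding complex_cnj_mult complex_cnj_cnj cis_cnj mult.assoc[symmetric] cis_mult
    by (simp add: left_diff_distrib)
  finally show ?thesis
    by (simp add: inner_eq_Re_cinner)
qed

lemma parseval_trigonometric_polynomial:
  fixes a :: "nat \<Rightarrow> 'a::complex_inner"
  shows "((\<lambda>t. (norm (\<Sum>n<N. cis (- (real n * t)) *\<^sub>C a n))\<^sup>2)
    has_integral (2 * pi * (\<Sum>n<N. (norm (a n))\<^sup>2))) {0..2 * pi}"
proof -
  have "((\<lambda>t. \<Sum>n<N. \<Sum>m<N. Re (cis (of_int (int m - int n) * t) * cinner (a n) (a m)))
      has_integral (\<Sum>n<N. \<Sum>m<N. if int m - int n = 0 then 2 * pi * Re (cinner (a n) (a m)) else 0))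
        {0..2 * pi}"
    by (intro has_integral_sum has_integral_Re_cis finite_lessThan)
  moreover have "(\<Sum>m<N. if int m - int n = 0 then 2 * pi * Re (cinner (a n) (a m)) else 0)
      = 2 * pi * (norm (a n))\<^sup>2" if "n < N" for n
    using that by (simp add: power2_norm_eq_inner inner_eq_Re_cinner)
  moreover have "(norm (\<Sum>n<N. cis (- (real n * t)) *\<^sub>C a n))\<^sup>2
      = (\<Sum>n<N. \<Sum>m<N. Re (cis (of_int (int m - int n) * t) * cinner (a n) (a m)))" for t
    unfolding power2_norm_eq_inner inner_sum_left unfolding inner_sum_right inner_scaleC_cis ..
  ultimately show ?thesis
    by (simp add: sum_distrib_left)
qed

lemma summable_square_of_summable_norm:
  fixes a :: "nat \<Rightarrow> 'a::real_normed_vector"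
  assumes "summable (\<lambda>n. norm (a n))"
  shows "summable (\<lambda>n. (norm (a n))\<^sup>2)"
proof -
  obtain B where B: "\<And>n. norm (norm (a n)) \<le> B"
    using summable_imp_Bseq[OF assms, unfolded Bseq_def] by blast
  show ?thesis
    by (rule summable_comparison_test'[OF summable_mult[OF assms, of B]])
      (use B in \<open>auto simp: power2_eq_square intro: mult_right_mono\<close>)
qed

lemma parseval_trigonometric_series:
  fixes a :: "nat \<Rightarrow> 'a::complex_hilbert_space"
  assumes "summable (\<lambda>n. norm (a n))"
  shows "((\<lambda>t. (norm (\<Sum>n. cis (- (real n * t)) *\<^sub>C a n))\<^sup>2)
    has_integral (2 * pi * (\<Sum>n. (norm (a n))\<^sup>2))) {0..2 * pi}"
proof -
  let ?f = "\<lambda>N t. (norm (\<Sum>n<N. cis (- (real n * t)) *\<^sub>C a n))\<^sup>2"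
  let ?g = "\<lambda>t. (norm (\<Sum>n. cis (- (real n * t)) *\<^sub>C a n))\<^sup>2"
  have integrable: "?f N integrable_on {0..2 * pi}" for N
    using parseval_trigonometric_polynomial by blast
  have bound: "norm (?f N t) \<le> (\<Sum>n. norm (a n))\<^sup>2" for N t
  proof -
    have "norm (\<Sum>n<N. cis (- (real n * t)) *\<^sub>C a n) \<le> (\<Sum>n<N. norm (a n))"
      by (rule order_trans[OF norm_sum]) (simp add: norm_scaleC)
    also have "\<dots> \<le> (\<Sum>n. norm (a n))"
      by (rule sum_le_suminf[OF assms]) auto
    finally show ?thesis
      by (simp add: power_mono)
  qed
  have "summable (\<lambda>n. cis (- (real n * t)) *\<^sub>C a n)" for t
    by (rule summable_norm_cancel) (simp add: norm_scaleC assms)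
  then have limit: "(\<lambda>N. ?f N t) \<longlonglongrightarrow> ?g t" for t
    by (intro tendsto_intros summable_LIMSEQ)
  note dominated = dominated_convergence[OF integrable integrable_const_ivl bound limit]
  have "(\<lambda>N. integral {0..2 * pi} (?f N)) \<longlonglongrightarrow> 2 * pi * (\<Sum>n. (norm (a n))\<^sup>2)"
    unfolding integral_unique[OF parseval_trigonometric_polynomial]
    by (intro tendsto_intros summable_LIMSEQ summable_square_of_summable_norm assms)
  then have "integral {0..2 * pi} ?g = 2 * pi * (\<Sum>n. (norm (a n))\<^sup>2)"
    by (rule LIMSEQ_unique[OF dominated(2)])
  then show ?thesis
    using dominated(1) by (simp add: has_integral_integrable_integral)
qed

section \<open>Resolvents of power-bounded operators\<close>

lemma bounded_linear_funpow:
  fixes T :: "'a::real_normed_vector \<Rightarrow> 'a"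
  assumes "bounded_linear T"
  shows "bounded_linear (T ^^ n)"
proof (induction n)
  case 0
  then show ?case
    by (simp add: id_def bounded_linear_ident)
next
  case (Suc n)
  then show ?case
    using bounded_linear_compose[OF assms] by (simp add: comp_def)
qed

lemma bounded_linear_comp: "bounded_linear f \<Longrightarrow> bounded_linear g \<Longrightarrow> bounded_linear (f \<circ> g)"
  unfolding comp_def by (rule bounded_linear_compose)

lemma bounded_clinear_scaleC_minus:
  assumes "bounded_clinear S"
  shows "S (z *\<^sub>C x - y) = z *\<^sub>C S x - S y"
  using assms linear_diff[OF bounded_linear.linear, of S] by (auto simp: bounded_clinear_def)

locale power_bounded_operator =
  fixes T :: "'a::complex_hilbert_space \<Rightarrow> 'a"
  assumes bounded_clinear_T: "bounded_clinear T" and power_bounded_T: "power_bounded T"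
begin

definition power_bound :: real
  where "power_bound = (SUP n. onorm (T ^^ n))"

lemma bounded_linear_T: "bounded_linear T"
  using bounded_clinear_T by (simp add: bounded_clinear_def)

lemma T_scaleC: "T (a *\<^sub>C x) = a *\<^sub>C T x"
  using bounded_clinear_T by (simp add: bounded_clinear_def)

lemma onorm_funpow_le: "onorm (T ^^ n) \<le> power_bound"
  using power_bounded_T unfolding power_bound_def power_bounded_def by (rule cSUP_upper[OF UNIV_I])

lemma power_bound_nonneg: "0 \<le> power_bound"
  using onorm_pos_le[OF bounded_linear_funpow[OF bounded_linear_T], of 0] onorm_funpow_le[of 0]
  by linarith

lemma norm_funpow_le: "norm ((T ^^ n) x) \<le> power_bound * norm x"
proof -
  have "norm ((T ^^ n) x) \<le> onorm (T ^^ n) * norm x"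
    by (rule onorm[OF bounded_linear_funpow[OF bounded_linear_T]])
  also have "\<dots> \<le> power_bound * norm x"
    by (intro mult_right_mono onorm_funpow_le) simp
  finally show ?thesis .
qed

lemma linear_scaleC_minus: "linear (\<lambda>x. z *\<^sub>C x - T x)"
  by (intro bounded_linear.linear bounded_linear_sub bounded_linear_scaleC bounded_linear_T)

lemma inj_scaleC_minus:
  assumes "1 < cmod z"
  shows "inj (\<lambda>x. z *\<^sub>C x - T x)"
proof -
  have "x = 0" if "z *\<^sub>C x - T x = 0" for x
  proof (rule ccontr)
    assume "x \<noteq> 0"
    have "T x = z *\<^sub>C x"
      using that by simp
    then have "(T ^^ n) x = (z ^ n) *\<^sub>C x" for n
      by (induction n) (auto simp: scaleC_one T_scaleC scaleC_scaleC mult.commute)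
    then have "cmod z ^ n * norm x \<le> power_bound * norm x" for n
      using norm_funpow_le[of n x] by (simp add: norm_scaleC norm_power)
    with \<open>x \<noteq> 0\<close> have "cmod z ^ n \<le> power_bound" for n
      by simp
    then show False
      using real_arch_pow[OF assms, of power_bound] by (auto simp: not_less[symmetric])
  qed
  then show ?thesis
    by (simp add: linear_injective_0[OF linear_scaleC_minus])
qed

lemma resolvent_eqI:
  assumes "1 < cmod z" "z *\<^sub>C y - T y = x"
  shows "resolvent z T x = y"
  unfolding resolvent_def using inj_scaleC_minus[OF assms(1)] assms(2) by (rule inv_f_eq)

lemma summable_norm_resolvent_series:
  assumes "1 < cmod z"
  shows "summable (\<lambda>n. norm (resolvent_coeff m z n *\<^sub>C (T ^^ n) x))"
proof (rule summable_comparison_test')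
  show "summable (\<lambda>n. resolvent_coeff m (cmod z) n * (power_bound * norm x))"
    by (intro summable_mult2 sums_summable[OF sums_resolvent_coeff[OF assms]])
  show "norm (norm (resolvent_coeff m z n *\<^sub>C (T ^^ n) x))
      \<le> resolvent_coeff m (cmod z) n * (power_bound * norm x)" for n
    by (simp add: norm_scaleC norm_resolvent_coeff mult_left_mono norm_funpow_le
        resolvent_coeff_nonneg)
qed

lemma resolvent_series_Suc:
  assumes "z \<noteq> 0" and v: "(\<lambda>n. resolvent_coeff m z n *\<^sub>C (T ^^ n) x) sums v"
    and w: "(\<lambda>n. resolvent_coeff (Suc m) z n *\<^sub>C (T ^^ n) x) sums w"
  shows "z *\<^sub>C w - T w = v"
proof -
  define g where "g n = z *\<^sub>C (resolvent_coeff (Suc m) z n *\<^sub>C (T ^^ n) x)" for n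
  define h where "h n = T (resolvent_coeff (Suc m) z n *\<^sub>C (T ^^ n) x)" for n
  have g: "g sums (z *\<^sub>C w)"
    unfolding g_def by (rule bounded_linear.sums[OF bounded_linear_scaleC w])
  have h: "h sums T w"
    unfolding h_def by (rule bounded_linear.sums[OF bounded_linear_T w])
  have g_0: "g 0 = resolvent_coeff m z 0 *\<^sub>C (T ^^ 0) x"
    unfolding g_def scaleC_scaleC resolvent_coeff_Suc_0[OF \<open>z \<noteq> 0\<close>] ..
  have g_Suc: "g (Suc n) = resolvent_coeff m z (Suc n) *\<^sub>C (T ^^ Suc n) x + h n" for n
    unfolding g_def h_def scaleC_scaleC resolvent_coeff_Suc_Suc[OF \<open>z \<noteq> 0\<close>]
    by (simp add: scaleC_add_left T_scaleC)
  have "(\<lambda>n. resolvent_coeff m z (Suc n) *\<^sub>C (T ^^ Suc n) x) sums (v - g 0)"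
    using v sums_Suc_iff[of "\<lambda>n. resolvent_coeff m z n *\<^sub>C (T ^^ n) x" "v - g 0"] by (simp add: g_0)
  from sums_add[OF this h] have "(\<lambda>n. g (Suc n)) sums (v - g 0 + T w)"
    unfolding g_Suc .
  then have "g sums (v + T w)"
    using sums_Suc[of g] by fastforce
  then have "z *\<^sub>C w = v + T w"
    using g by (rule sums_unique2[symmetric])
  then show ?thesis
    by simp
qed

lemma resolvent_power_series:
  assumes "1 < cmod z"
  shows "(\<lambda>n. resolvent_coeff m z n *\<^sub>C (T ^^ n) x) sums (resolvent z T ^^ m) x"
proof (induction m)
  case 0
  have "(\<lambda>n. resolvent_coeff 0 z n *\<^sub>C (T ^^ n) x) = (\<lambda>n. if n = 0 then x else 0)"
    by (auto simp: resolvent_coeff_0 scaleC_one scaleC_zero)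
  then show ?case
    using sums_single[of 0 "\<lambda>_. x"] by simp
next
  case (Suc m)
  define w where "w = (\<Sum>n. resolvent_coeff (Suc m) z n *\<^sub>C (T ^^ n) x)"
  have w: "(\<lambda>n. resolvent_coeff (Suc m) z n *\<^sub>C (T ^^ n) x) sums w"
    unfolding w_def
    by (rule summable_sums[OF summable_norm_cancel[OF summable_norm_resolvent_series[OF assms]]])
  have "resolvent z T ((resolvent z T ^^ m) x) = w"
    using assms by (intro resolvent_eqI resolvent_series_Suc[OF _ Suc.IH w]) auto
  then show ?case
    using w by simp
qed

lemma scaleC_resolvent_minus:
  assumes "1 < cmod z"
  shows "z *\<^sub>C resolvent z T x - T (resolvent z T x) = x"
  using resolvent_series_Suc[OF _ resolvent_power_series[OF assms, of 0]
      resolvent_power_series[OF assms], of x] assms by fastforce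

lemma norm_resolvent_power_le:
  assumes "1 < cmod z" and "\<And>n. norm ((T ^^ n) x) \<le> b n"
    and "(\<lambda>n. resolvent_coeff m (cmod z) n * b n) sums B"
  shows "norm ((resolvent z T ^^ m) x) \<le> B"
proof -
  have "norm (\<Sum>n. resolvent_coeff m z n *\<^sub>C (T ^^ n) x) \<le> (\<Sum>n. resolvent_coeff m (cmod z) n * b n)"
    by (rule norm_suminf_le[OF _ sums_summable[OF assms(3)]])
      (simp add: norm_scaleC norm_resolvent_coeff mult_left_mono assms(2) resolvent_coeff_nonneg)
  then show ?thesis
    using assms(3) resolvent_power_series[OF assms(1), of m x] by (simp add: sums_iff)
qed

lemma bounded_linear_funpow_comp: "bounded_linear S \<Longrightarrow> bounded_linear ((T ^^ n) \<circ> S)"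
  by (intro bounded_linear_comp bounded_linear_funpow bounded_linear_T)

lemma onorm_resolvent_power_comp_le:
  assumes "1 < cmod z" "bounded_linear S" and b: "\<And>n. onorm ((T ^^ n) \<circ> S) \<le> b n"
    and B: "(\<lambda>n. resolvent_coeff m (cmod z) n * b n) sums B"
  shows "onorm ((resolvent z T ^^ m) \<circ> S) \<le> B"
proof (rule onorm_bound)
  have "0 \<le> b n" for n
    using onorm_pos_le[OF bounded_linear_funpow_comp[OF assms(2)]] b by (rule order_trans)
  then show "0 \<le> B"
    by (intro sums_le[OF _ sums_zero B] mult_nonneg_nonneg resolvent_coeff_nonneg) auto
  fix x
  have "norm ((T ^^ n) (S x)) \<le> b n * norm x" for n
    using order_trans[OF onorm[OF bounded_linear_funpow_comp[OF assms(2)]] mult_right_mono[OF b]]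
    by simp
  then have "norm ((resolvent z T ^^ m) (S x)) \<le> B * norm x"
    by (rule norm_resolvent_power_le[OF assms(1)])
      (use sums_mult2[OF B, of "norm x"] in \<open>simp only: mult.assoc\<close>)
  then show "norm (((resolvent z T ^^ m) \<circ> S) x) \<le> B * norm x"
    by simp
qed

lemma bounded_linear_resolvent:
  assumes "1 < cmod z"
  shows "bounded_linear (resolvent z T)"
proof (rule bounded_linear_intro)
  let ?R = "resolvent z T"
  fix x y :: 'a and r :: real
  show "?R (x + y) = ?R x + ?R y"
    by (rule resolvent_eqI[OF assms])
      (simp add: linear_add[OF linear_scaleC_minus] scaleC_resolvent_minus[OF assms])
  show "?R (r *\<^sub>R x) = r *\<^sub>R ?R x"
    by (rule resolvent_eqI[OF assms])
      (simp add: linear_scale[OF linear_scaleC_minus] scaleC_resolvent_minus[OF assms])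
  show "norm (?R x) \<le> norm x * (power_bound / (cmod z - 1))"
    using norm_resolvent_power_le[OF assms norm_funpow_le
        sums_mult2[OF sums_resolvent_coeff[OF assms]], of 1 x]
    by (simp add: mult.commute)
qed

lemma resolvent_commute:
  assumes "1 < cmod z" "bounded_clinear S" "S \<circ> T = T \<circ> S"
  shows "resolvent z T (S x) = S (resolvent z T x)"
proof (rule resolvent_eqI[OF assms(1)])
  have "z *\<^sub>C S (resolvent z T x) - T (S (resolvent z T x)) =
      S (z *\<^sub>C resolvent z T x - T (resolvent z T x))"
    using assms(3) by (simp add: bounded_clinear_scaleC_minus[OF assms(2)] fun_eq_iff)
  then show "z *\<^sub>C S (resolvent z T x) - T (S (resolvent z T x)) = S x"
    by (simp add: scaleC_resolvent_minus[OF assms(1)])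
qed

lemma norm_resolvent_power_polar:
  assumes "1 < r"
  shows "norm ((resolvent (of_real r * cis t) T ^^ m) x) =
    norm (\<Sum>n. cis (- (real n * t)) *\<^sub>C (of_real (resolvent_coeff m r n) *\<^sub>C (T ^^ n) x))"
proof -
  let ?z = "of_real r * cis t"
  have "1 < cmod ?z"
    using assms by (simp add: norm_mult)
  then have "(\<lambda>n. cis (real m * t) *\<^sub>C (resolvent_coeff m ?z n *\<^sub>C (T ^^ n) x)) sums
      (cis (real m * t) *\<^sub>C (resolvent ?z T ^^ m) x)"
    by (intro bounded_linear.sums[OF bounded_linear_scaleC] resolvent_power_series)
  moreover have "cis (real m * t) *\<^sub>C (resolvent_coeff m ?z n *\<^sub>C (T ^^ n) x)
      = cis (- (real n * t)) *\<^sub>C (of_real (resolvent_coeff m r n) *\<^sub>C (T ^^ n) x)" for n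
    by (simp add: resolvent_coeff_polar scaleC_scaleC cis_mult flip: mult.assoc)
  ultimately show ?thesis
    by (simp add: sums_iff norm_scaleC)
qed

lemma parseval_resolvent_power:
  assumes "1 < r"
  shows "summable (\<lambda>n. (resolvent_coeff m r n * norm ((T ^^ n) x))\<^sup>2)"
    and "((\<lambda>t. (norm ((resolvent (of_real r * cis t) T ^^ m) x))\<^sup>2) has_integral
      2 * pi * (\<Sum>n. (resolvent_coeff m r n * norm ((T ^^ n) x))\<^sup>2)) {0..2 * pi}"
proof -
  define a where "a n = of_real (resolvent_coeff m r n) *\<^sub>C (T ^^ n) x" for n
  have norm_a: "norm (a n) = resolvent_coeff m r n * norm ((T ^^ n) x)" for n
    using assms by (simp add: a_def norm_scaleC resolvent_coeff_nonneg)
  have "summable (\<lambda>n. norm (a n))"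
    using summable_norm_resolvent_series[of "of_real r" m x] assms
    by (simp add: norm_a norm_scaleC norm_resolvent_coeff)
  then show "summable (\<lambda>n. (resolvent_coeff m r n * norm ((T ^^ n) x))\<^sup>2)"
    and "((\<lambda>t. (norm ((resolvent (of_real r * cis t) T ^^ m) x))\<^sup>2) has_integral
      2 * pi * (\<Sum>n. (resolvent_coeff m r n * norm ((T ^^ n) x))\<^sup>2)) {0..2 * pi}"
    using summable_square_of_summable_norm[of a] parseval_trigonometric_series[of a]
    unfolding norm_a by (simp_all add: norm_resolvent_power_polar[OF assms] a_def)
qed

lemma suminf_square_resolvent_coeff_1_le:
  assumes "1 < r"
  shows "(\<Sum>n. (resolvent_coeff 1 r n * norm ((T ^^ n) x))\<^sup>2) \<le> (power_bound * norm x)\<^sup>2 / (r - 1)"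
proof (rule sums_le[OF _ summable_sums[OF parseval_resolvent_power(1)[OF assms]]])
  show "(\<lambda>n. resolvent_coeff 1 r n * (power_bound * norm x)\<^sup>2) sums
      ((power_bound * norm x)\<^sup>2 / (r - 1))"
    using sums_mult2[OF sums_resolvent_coeff[OF assms, of 1]] by simp
  fix n
  have "0 \<le> resolvent_coeff 1 r n" "resolvent_coeff 1 r n \<le> 1"
    using resolvent_coeff_Suc_le_power[of r 0 n] assms by (auto simp: resolvent_coeff_nonneg)
  then have "(resolvent_coeff 1 r n)\<^sup>2 \<le> resolvent_coeff 1 r n"
    by (simp add: power2_eq_square mult_left_le)
  moreover have "(norm ((T ^^ n) x))\<^sup>2 \<le> (power_bound * norm x)\<^sup>2"
    by (intro power_mono norm_funpow_le) auto
  ultimately show "(resolvent_coeff 1 r n * norm ((T ^^ n) x))\<^sup>2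
      \<le> resolvent_coeff 1 r n * (power_bound * norm x)\<^sup>2"
    unfolding power_mult_distrib[of "resolvent_coeff 1 r n"]
    using \<open>0 \<le> resolvent_coeff 1 r n\<close> by (intro mult_mono) auto
qed

lemma suminf_square_resolvent_coeff_Suc_le:
  assumes "1 < r" and S: "bounded_clinear S" "S \<circ> T = T \<circ> S"
    and A: "\<And>z. cmod z = r \<Longrightarrow> onorm ((resolvent z T ^^ k) \<circ> S) \<le> A"
  shows "(\<Sum>n. (resolvent_coeff (Suc k) r n * norm ((T ^^ n) (S x)))\<^sup>2)
    \<le> (A * power_bound * norm x)\<^sup>2 / (r - 1)"
proof -
  let ?b = "\<lambda>n. (resolvent_coeff (Suc k) r n * norm ((T ^^ n) (S x)))\<^sup>2"
  let ?a = "\<lambda>n. (resolvent_coeff 1 r n * norm ((T ^^ n) x))\<^sup>2"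
  have "(norm ((resolvent (of_real r * cis t) T ^^ Suc k) (S x)))\<^sup>2
      \<le> A\<^sup>2 * (norm ((resolvent (of_real r * cis t) T ^^ 1) x))\<^sup>2" for t
  proof -
    define z where "z = of_real r * cis t"
    have z: "cmod z = r" "1 < cmod z"
      using \<open>1 < r\<close> by (auto simp: z_def norm_mult)
    have "bounded_linear ((resolvent z T ^^ k) \<circ> S)"
      using S(1) unfolding bounded_clinear_def
      by (intro bounded_linear_comp bounded_linear_funpow bounded_linear_resolvent z) simp
    from onorm[OF this] have "norm ((resolvent z T ^^ k) (S (resolvent z T x)))
        \<le> onorm ((resolvent z T ^^ k) \<circ> S) * norm (resolvent z T x)"
      by simp
    also have "\<dots> \<le> A * norm (resolvent z T x)"
      by (intro mult_right_mono A z) simp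
    finally have "norm ((resolvent z T ^^ Suc k) (S x)) \<le> A * norm (resolvent z T x)"
      by (simp add: funpow_swap1 resolvent_commute[OF z(2) S])
    then show ?thesis
      unfolding z_def[symmetric] power_mult_distrib[symmetric] by (intro power_mono) auto
  qed
  then have "2 * pi * suminf ?b \<le> A\<^sup>2 * (2 * pi * suminf ?a)"
    by (intro has_integral_le[OF parseval_resolvent_power(2)[OF assms(1)]
          has_integral_mult_right[OF parseval_resolvent_power(2)[OF assms(1)]]])
  then have "suminf ?b \<le> A\<^sup>2 * suminf ?a"
    by simp
  also have "\<dots> \<le> A\<^sup>2 * ((power_bound * norm x)\<^sup>2 / (r - 1))"
    by (intro mult_left_mono suminf_square_resolvent_coeff_1_le assms(1)) simp
  finally show ?thesis
    by (simp add: power_mult_distrib mult.assoc)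
qed

lemma sum_resolvent_coeff_norm_le:
  assumes S: "bounded_clinear S" "S \<circ> T = T \<circ> S" and "0 < N" "0 \<le> A" and r: "r = 1 + 1 / real N"
    and A: "\<And>z. cmod z = r \<Longrightarrow> onorm ((resolvent z T ^^ k) \<circ> S) \<le> A"
  shows "(\<Sum>n<N. resolvent_coeff (Suc k) r n * norm ((T ^^ n) (S x)))
    \<le> A * power_bound * norm x * real N"
proof -
  let ?c = "\<lambda>n. resolvent_coeff (Suc k) r n * norm ((T ^^ n) (S x))"
  have "1 < r" "1 / (r - 1) = real N"
    using \<open>0 < N\<close> by (auto simp: r)
  have "(\<Sum>n<N. (?c n)\<^sup>2) \<le> (\<Sum>n. (?c n)\<^sup>2)"
    by (rule sum_le_suminf[OF parseval_resolvent_power(1)[OF \<open>1 < r\<close>]]) auto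
  also have "\<dots> \<le> (A * power_bound * norm x)\<^sup>2 / (r - 1)"
    by (rule suminf_square_resolvent_coeff_Suc_le[OF \<open>1 < r\<close> S A])
  also have "\<dots> = (A * power_bound * norm x)\<^sup>2 * real N"
    unfolding \<open>1 / (r - 1) = real N\<close>[symmetric] by simp
  finally have "(\<Sum>n<N. (?c n)\<^sup>2) * real N \<le> (A * power_bound * norm x)\<^sup>2 * real N * real N"
    by (rule mult_right_mono) simp
  then have "(\<Sum>n<N. ?c n)\<^sup>2 \<le> (A * power_bound * norm x * real N)\<^sup>2"
    using sum_squared_le_sum_of_squares[of ?c "{..<N}"] by (simp add: power2_eq_square mult_ac)
  then show ?thesis
    by (rule power2_le_imp_le) (use power_bound_nonneg \<open>0 \<le> A\<close> in auto)
qed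

lemma onorm_funpow_comp_le:
  assumes S: "bounded_clinear S" "S \<circ> T = T \<circ> S" and "0 < N" "0 \<le> A"
    and A: "\<And>z. cmod z = 1 + 1 / real N \<Longrightarrow> onorm ((resolvent z T ^^ k) \<circ> S) \<le> A"
  shows "onorm ((T ^^ N) \<circ> S) \<le> fact (Suc k) * exp (real (Suc k)) * power_bound\<^sup>2 * A / real N ^ k"
proof (rule onorm_bound)
  let ?E = "fact (Suc k) * exp (real (Suc k)) :: real"
  show "0 \<le> ?E * power_bound\<^sup>2 * A / real N ^ k"
    using \<open>0 \<le> A\<close> by simp
  fix x
  define c where "c = resolvent_coeff (Suc k) (1 + 1 / real N)"
  have c_nonneg: "0 \<le> c n" for n
    by (simp add: c_def resolvent_coeff_nonneg)
  have "norm ((T ^^ N) (S x)) \<le> power_bound * norm ((T ^^ n) (S x))" if "n < N" for n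
    using norm_funpow_le[of "N - n" "(T ^^ n) (S x)"] that
    by (metis comp_apply funpow_add le_add_diff_inverse2 less_imp_le)
  then have "(\<Sum>n<N. c n) * norm ((T ^^ N) (S x))
      \<le> (\<Sum>n<N. c n * (power_bound * norm ((T ^^ n) (S x))))"
    unfolding sum_distrib_right using c_nonneg by (intro sum_mono mult_left_mono) auto
  also have "\<dots> = power_bound * (\<Sum>n<N. c n * norm ((T ^^ n) (S x)))"
    by (simp add: sum_distrib_left mult_ac)
  also have "\<dots> \<le> power_bound * (A * power_bound * norm x * real N)"
    unfolding c_def
    by (intro mult_left_mono power_bound_nonneg sum_resolvent_coeff_norm_le S A refl
        \<open>0 < N\<close> \<open>0 \<le> A\<close>)
  finally have weighted: "(\<Sum>n<N. c n) * norm ((T ^^ N) (S x))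
      \<le> power_bound * (A * power_bound * norm x * real N)" .
  have "real N ^ Suc k * norm ((T ^^ N) (S x)) \<le> ?E * (\<Sum>n<N. c n) * norm ((T ^^ N) (S x))"
    unfolding c_def by (intro mult_right_mono power_le_sum_resolvent_coeff) simp
  also have "\<dots> \<le> ?E * (power_bound * (A * power_bound * norm x * real N))"
    unfolding mult.assoc[of ?E] by (rule mult_left_mono[OF weighted]) simp
  finally have "real N * (real N ^ k * norm ((T ^^ N) (S x)))
      \<le> real N * (?E * power_bound\<^sup>2 * A * norm x)"
    by (simp add: power2_eq_square mult_ac del: fact_Suc of_nat_Suc)
  then show "norm (((T ^^ N) \<circ> S) x) \<le> ?E * power_bound\<^sup>2 * A / real N ^ k * norm x"
    using \<open>0 < N\<close> by (simp add: field_simps del: fact_Suc of_nat_Suc)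
qed

theorem resolvent_bound_of_decay:
  assumes S: "bounded_linear S" and f: "bounded_regularly_varying \<alpha> f"
    and bdd: "\<And>b. 0 < b \<Longrightarrow> bdd_above (f ` {0<..b})"
    and k: "0 \<le> \<alpha>" "\<alpha> < real k" "1 \<le> k"
    and decay: "(\<lambda>n. onorm ((T ^^ n) \<circ> S)) \<in> O(\<lambda>n. 1 / f (real n))"
  shows "\<exists>M>0. \<forall>z. 1 < cmod z \<longrightarrow>
    onorm ((resolvent z T ^^ k) \<circ> S) \<le> M / ((cmod z - 1) ^ k * f (1 / (cmod z - 1)))"
proof -
  obtain C where "0 < C" and C: "\<And>n s. 0 < s \<Longrightarrow>
      f s * \<bar>onorm ((T ^^ n) \<circ> S)\<bar> \<le> C * max 1 ((s / (real n + 1)) powr \<alpha>)"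
    using decay_rate_le_max_powr[OF f k(1) bdd decay] by metis
  obtain D where "0 < D" and D: "\<And>r s. 1 < r \<Longrightarrow> s = 1 / (r - 1) \<Longrightarrow> \<exists>B\<le>D * s ^ k.
      (\<lambda>n. resolvent_coeff k r n * max 1 ((s / (real n + 1)) powr \<alpha>)) sums B"
    using resolvent_coeff_max_powr_bounded[OF k] by blast
  have "onorm ((resolvent z T ^^ k) \<circ> S) \<le> C * D / ((cmod z - 1) ^ k * f (1 / (cmod z - 1)))"
    if z: "1 < cmod z" for z
  proof -
    define s where "s = 1 / (cmod z - 1)"
    have "0 < s"
      using z by (simp add: s_def)
    then have "0 < f s"
      by (rule bounded_regularly_varying_pos[OF f])
    obtain B where "B \<le> D * s ^ k"
      and B: "(\<lambda>n. resolvent_coeff k (cmod z) n * max 1 ((s / (real n + 1)) powr \<alpha>)) sums B"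
      using D[OF z s_def] by blast
    have "onorm ((T ^^ n) \<circ> S) \<le> max 1 ((s / (real n + 1)) powr \<alpha>) * (C / f s)" for n
    proof -
      have "f s * onorm ((T ^^ n) \<circ> S) \<le> f s * \<bar>onorm ((T ^^ n) \<circ> S)\<bar>"
        using \<open>0 < f s\<close> by simp
      with C[OF \<open>0 < s\<close>, of n]
      have "f s * onorm ((T ^^ n) \<circ> S) \<le> C * max 1 ((s / (real n + 1)) powr \<alpha>)"
        by (rule order_trans[rotated])
      with \<open>0 < f s\<close> show ?thesis
        by (simp add: pos_le_divide_eq mult.commute)
    qed
    then have "onorm ((resolvent z T ^^ k) \<circ> S) \<le> B * (C / f s)"
      by (rule onorm_resolvent_power_comp_le[OF z S])
        (use sums_mult2[OF B] in \<open>simp only: mult.assoc\<close>)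
    also have "\<dots> \<le> D * s ^ k * (C / f s)"
      using \<open>B \<le> D * s ^ k\<close> \<open>0 < C\<close> \<open>0 < f s\<close> by (intro mult_right_mono) auto
    finally show ?thesis
      by (simp add: s_def power_one_over mult_ac)
  qed
  then show ?thesis
    using \<open>0 < C\<close> \<open>0 < D\<close> by (intro exI[of _ "C * D"]) auto
qed

theorem decay_of_resolvent_bound:
  assumes S: "bounded_clinear S" "S \<circ> T = T \<circ> S" and pos: "\<And>t. 0 < t \<Longrightarrow> 0 < f t" and "0 < M"
    and bound: "\<And>z. 1 < cmod z \<Longrightarrow>
      onorm ((resolvent z T ^^ k) \<circ> S) \<le> M / ((cmod z - 1) ^ k * f (1 / (cmod z - 1)))"
  shows "(\<lambda>n. onorm ((T ^^ n) \<circ> S)) \<in> O(\<lambda>n. 1 / f (real n))"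
proof (rule bigoI)
  let ?c = "fact (Suc k) * exp (real (Suc k)) * power_bound\<^sup>2 * M"
  show "\<forall>\<^sub>F n in sequentially. norm (onorm ((T ^^ n) \<circ> S)) \<le> ?c * norm (1 / f (real n))"
    using eventually_gt_at_top[of 0]
  proof eventually_elim
    case (elim n)
    have "0 < f (real n)"
      using pos elim by simp
    have "onorm ((resolvent z T ^^ k) \<circ> S) \<le> M * real n ^ k / f (real n)"
      if "cmod z = 1 + 1 / real n" for z
      using bound[of z] elim by (simp add: that power_one_over)
    then have "onorm ((T ^^ n) \<circ> S)
        \<le> fact (Suc k) * exp (real (Suc k)) * power_bound\<^sup>2 *
          (M * real n ^ k / f (real n)) / real n ^ k"
      using S elim \<open>0 < M\<close> \<open>0 < f (real n)\<close> by (intro onorm_funpow_comp_le) auto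
    also have "\<dots> = ?c * norm (1 / f (real n))"
      using elim \<open>0 < f (real n)\<close> by simp
    finally show ?case
      using onorm_pos_le[OF bounded_linear_funpow_comp[of S n]] S(1)
      by (simp add: bounded_clinear_def)
  qed
qed

end

theorem theorem3p1:
  fixes T S :: "'a::complex_hilbert_space \<Rightarrow> 'a"
    and \<alpha> :: real and k :: nat and f :: "real \<Rightarrow> real"
  assumes "bounded_clinear T" and "power_bounded T"
    and "bounded_clinear S" and "S \<circ> T = T \<circ> S"
    and "\<alpha> > 0" and "k \<ge> 1" and "real k > \<alpha>"
    and "bounded_regularly_varying \<alpha> f"
    and "\<And>b. b > 0 \<Longrightarrow> bdd_above (f ` {0<..b})"
  shows "(\<lambda>n. onorm ((T ^^ n) \<circ> S)) \<in> O(\<lambda>n. 1 / f (real n)) \<longleftrightarrow>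
    (\<exists>M>0. \<forall>z::complex. norm z > 1 \<longrightarrow>
      onorm ((resolvent z T ^^ k) \<circ> S) \<le> M / ((norm z - 1) ^ k * f (1 / (norm z - 1))))"
proof -
  interpret power_bounded_operator T
    using assms(1,2) by unfold_locales
  show ?thesis
  proof
    assume "(\<lambda>n. onorm ((T ^^ n) \<circ> S)) \<in> O(\<lambda>n. 1 / f (real n))"
    moreover have "bounded_linear S" "0 \<le> \<alpha>"
      using assms(3,5) by (auto simp: bounded_clinear_def)
    ultimately show "\<exists>M>0. \<forall>z. norm z > 1 \<longrightarrow>
        onorm ((resolvent z T ^^ k) \<circ> S) \<le> M / ((norm z - 1) ^ k * f (1 / (norm z - 1)))"
      using assms(6-9) by (intro resolvent_bound_of_decay)
  next
    assume "\<exists>M>0. \<forall>z. norm z > 1 \<longrightarrow>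
      onorm ((resolvent z T ^^ k) \<circ> S) \<le> M / ((norm z - 1) ^ k * f (1 / (norm z - 1)))"
    moreover have "0 < f t" if "0 < t" for t
      by (rule bounded_regularly_varying_pos[OF assms(8) that])
    ultimately show "(\<lambda>n. onorm ((T ^^ n) \<circ> S)) \<in> O(\<lambda>n. 1 / f (real n))"
      using assms(3,4) decay_of_resolvent_bound by blast
  qed
qed

end
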